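(* Let $n\ge 1$, let $A_2^{\ast}$ be the free monoid on a two-letter alphabet and let $(A_2^{\ast})^n$ be its $n$-fold direct product, regarded as an $n$-monoid. Then $\mathscr{G}((A_2^{\ast})^n)\cong nV$, where $nV$ is Brin's $n$-dimensional Thompson group.
   Context: For a monoid $S$ such as $(A_2^\ast)^n$, in which the intersection of any two principal right ideals is empty or finitely generated, $\mathsf{R}(S)$ is the inverse monoid, under composition of partial functions, of all bijective morphisms $\alpha\colon XS\to YS$ between finitely generated right ideals of $S$ ($X,Y$ finite, the empty ideal and empty function included), where a morphism satisfies $\alpha(as)=\alpha(a)s$ for all $a\in XS$, $s\in S$. In an inverse semigroup $T$ with zero, a non-zero idempotent $e$ is essential if $ef\neq 0$ for every non-zero idempotent $f$; $T^e$ is the inverse subsemigroup of all $s\in T$ with $s^{-1}s$ and $ss^{-1}$ essential. $\sigma$ is the minimum group congruence: $s\,\sigma\,t$ iff there is $u\le s,t$ in the natural partial order. Then $\mathscr{G}(S)=\mathsf{R}(S)^e/\sigma$. Brin's group $nV$: a dyadic pattern is a partition of $[0,1)^n$ into finitely many boxes (products of half-open intervals $[a,b)$) obtained from the trivial partition by finitely many times choosing a box and a coordinate direction and replacing the box by its two half-open halves in that direction. $nV$ is the group of all bijections $f$ of $[0,1)^n$ for which there are dyadic patterns $P_1,\dots,P_r$ and $Q_1,\dots,Q_r$ with the same number of boxes such that $f$ maps each $P_i$ onto $Q_i$ by the affine map that is increasing in each coordinate separately (translation composed with coordinatewise positive scaling). *)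

theory Defs
  imports Complex_Main "HOL-Algebra.Bij" "HOL-Algebra.Coset" "HOL-Algebra.Product_Groups"
begin

section \<open>Inverse semigroups\<close>

text \<open>
  The record type \<open>monoid\<close> serves as carrier for semigroups with zero. The element selected by
  \<open>THE\<close> in \<open>sg_inv\<close> and \<open>sg_zero\<close> exists and is unique whenever the structure is an inverse
  semigroup, respectively a semigroup with zero.
\<close>

definition idems :: "('a, 'b) monoid_scheme \<Rightarrow> 'a set" where
  "idems T = {e \<in> carrier T. e \<otimes>\<^bsub>T\<^esub> e = e}"

definition sg_zero :: "('a, 'b) monoid_scheme \<Rightarrow> 'a" where
  "sg_zero T = (THE z. z \<in> carrier T \<and> (\<forall>x\<in>carrier T. z \<otimes>\<^bsub>T\<^esub> x = z \<and> x \<otimes>\<^bsub>T\<^esub> z = z))"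

definition sg_inv :: "('a, 'b) monoid_scheme \<Rightarrow> 'a \<Rightarrow> 'a" where
  "sg_inv T s = (THE t. t \<in> carrier T \<and> s \<otimes>\<^bsub>T\<^esub> t \<otimes>\<^bsub>T\<^esub> s = s \<and> t \<otimes>\<^bsub>T\<^esub> s \<otimes>\<^bsub>T\<^esub> t = t)"

definition essential_idem :: "('a, 'b) monoid_scheme \<Rightarrow> 'a \<Rightarrow> bool" where
  "essential_idem T e \<longleftrightarrow> e \<in> idems T \<and> e \<noteq> sg_zero T \<and>
     (\<forall>f\<in>idems T. f \<noteq> sg_zero T \<longrightarrow> e \<otimes>\<^bsub>T\<^esub> f \<noteq> sg_zero T)"

definition essential_part :: "('a, 'b) monoid_scheme \<Rightarrow> ('a, 'b) monoid_scheme" where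
  "essential_part T = T\<lparr>carrier := {s \<in> carrier T.
     essential_idem T (sg_inv T s \<otimes>\<^bsub>T\<^esub> s) \<and> essential_idem T (s \<otimes>\<^bsub>T\<^esub> sg_inv T s)}\<rparr>"

definition natural_le :: "('a, 'b) monoid_scheme \<Rightarrow> 'a \<Rightarrow> 'a \<Rightarrow> bool" where
  "natural_le T s t \<longleftrightarrow> (\<exists>e\<in>idems T. s = t \<otimes>\<^bsub>T\<^esub> e)"

definition sigma_cong :: "('a, 'b) monoid_scheme \<Rightarrow> ('a \<times> 'a) set" where
  "sigma_cong T = {(s, t). s \<in> carrier T \<and> t \<in> carrier T \<and>
     (\<exists>u\<in>carrier T. natural_le T u s \<and> natural_le T u t)}"

text \<open>
  The quotient by a congruence: for a congruence \<open>r\<close> the product below is the class of \<open>a \<otimes> b\<close>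
  for any representatives \<open>a \<in> A\<close> and \<open>b \<in> B\<close>.
\<close>

definition quotient_monoid :: "('a, 'b) monoid_scheme \<Rightarrow> ('a \<times> 'a) set \<Rightarrow> 'a set monoid" where
  "quotient_monoid T r =
     \<lparr>carrier = carrier T // r, mult = (\<lambda>A B. r `` (A <#>\<^bsub>T\<^esub> B)), one = r `` {\<one>\<^bsub>T\<^esub>}\<rparr>"


section \<open>Bijective morphisms between finitely generated right ideals\<close>

definition fg_right_ideal :: "('a, 'b) monoid_scheme \<Rightarrow> 'a set \<Rightarrow> bool" where
  "fg_right_ideal S I \<longleftrightarrow> (\<exists>X. finite X \<and> X \<subseteq> carrier S \<and> I = X <#>\<^bsub>S\<^esub> carrier S)"

text \<open>A morphism \<open>XS \<rightarrow> YS\<close> is a partial map with domain \<open>XS\<close> and range \<open>YS\<close>.\<close>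

definition bij_morphism :: "('a, 'b) monoid_scheme \<Rightarrow> ('a \<rightharpoonup> 'a) \<Rightarrow> bool" where
  "bij_morphism S \<alpha> \<longleftrightarrow>
     fg_right_ideal S (dom \<alpha>) \<and> fg_right_ideal S (ran \<alpha>) \<and> inj_on \<alpha> (dom \<alpha>) \<and>
     (\<forall>a b. \<forall>s\<in>carrier S. \<alpha> a = Some b \<longrightarrow> \<alpha> (a \<otimes>\<^bsub>S\<^esub> s) = Some (b \<otimes>\<^bsub>S\<^esub> s))"

definition R_monoid :: "('a, 'b) monoid_scheme \<Rightarrow> ('a \<rightharpoonup> 'a) monoid" where
  "R_monoid S = \<lparr>carrier = {\<alpha>. bij_morphism S \<alpha>}, mult = (\<circ>\<^sub>m), one = Some |` carrier S\<rparr>"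

definition G_group :: "('a, 'b) monoid_scheme \<Rightarrow> ('a \<rightharpoonup> 'a) set monoid" where
  "G_group S =
     (let T = essential_part (R_monoid S) in quotient_monoid T (sigma_cong T))"


section \<open>Powers of the free monoid on two letters\<close>

definition free_monoid :: "'a set \<Rightarrow> 'a list monoid" where
  "free_monoid A = \<lparr>carrier = lists A, mult = (@), one = []\<rparr>"

definition A2_power :: "nat \<Rightarrow> (nat \<Rightarrow> bool list) monoid" where
  "A2_power n = product_group {..<n} (\<lambda>_. free_monoid (UNIV :: bool set))"


section \<open>Brin's higher-dimensional Thompson groups\<close>

text \<open>
  Points of \<open>[0,1)\<^sup>n\<close> are real-valued functions on \<open>{..<n}\<close>, extended by \<open>undefined\<close>.
\<close>

definition hbox :: "nat \<Rightarrow> (nat \<Rightarrow> real) \<Rightarrow> (nat \<Rightarrow> real) \<Rightarrow> (nat \<Rightarrow> real) set" where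
  "hbox n a b = (\<Pi>\<^sub>E i\<in>{..<n}. {a i..<b i})"

abbreviation unit_cube :: "nat \<Rightarrow> (nat \<Rightarrow> real) set" where
  "unit_cube n \<equiv> hbox n (\<lambda>_. 0) (\<lambda>_. 1)"

inductive_set dyadic_patterns :: "nat \<Rightarrow> (nat \<Rightarrow> real) set set set" for n :: nat where
  trivial: "{unit_cube n} \<in> dyadic_patterns n"
| halve: "P \<in> dyadic_patterns n \<Longrightarrow> hbox n a b \<in> P \<Longrightarrow> i < n \<Longrightarrow> m = (a i + b i) / 2 \<Longrightarrow>
    (P - {hbox n a b}) \<union> {hbox n a (b(i := m)), hbox n (a(i := m)) b} \<in> dyadic_patterns n"

text \<open>
  \<open>f\<close> maps \<open>B\<close> onto \<open>C\<close> by a coordinatewise increasing affine map. For non-empty boxes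
  \<open>B\<close> and \<open>C\<close> there is exactly one such map.
\<close>

definition affine_box_map ::
  "nat \<Rightarrow> ((nat \<Rightarrow> real) \<Rightarrow> nat \<Rightarrow> real) \<Rightarrow> (nat \<Rightarrow> real) set \<Rightarrow> (nat \<Rightarrow> real) set \<Rightarrow> bool" where
  "affine_box_map n f B C \<longleftrightarrow> f ` B = C \<and>
     (\<exists>s t. (\<forall>i<n. s i > 0) \<and> (\<forall>x\<in>B. f x = (\<lambda>i\<in>{..<n}. s i * x i + t i)))"

text \<open>
  The numberings \<open>P\<^sub>1, \<dots>, P\<^sub>r\<close> and \<open>Q\<^sub>1, \<dots>, Q\<^sub>r\<close> are encoded by the bijection
  \<open>\<phi>\<close> sending \<open>P\<^sub>i\<close> to \<open>Q\<^sub>i\<close>.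
\<close>

definition brin_group :: "nat \<Rightarrow> ((nat \<Rightarrow> real) \<Rightarrow> nat \<Rightarrow> real) monoid" where
  "brin_group n = BijGroup (unit_cube n) \<lparr>carrier := {f \<in> Bij (unit_cube n).
     \<exists>P\<in>dyadic_patterns n. \<exists>Q\<in>dyadic_patterns n. \<exists>\<phi>.
       bij_betw \<phi> P Q \<and> (\<forall>B\<in>P. affine_box_map n f B (\<phi> B))}\<rparr>"

end

theory Submission
  imports Defs
begin

text \<open>
  A bijective morphism \<open>\<alpha>\<close> between right ideals of word tuples exchanges prefixes, and it is turned
  into a bijection of the cube by letting words act on points. A bit \<open>b\<close> acts on \<open>[0,1)\<close> by
  \<open>t \<mapsto> (b + t) / 2\<close>, so a word tuple \<open>x\<close> acts on the cube by an increasing affine map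
  \<open>p \<mapsto> x p\<close> onto a dyadic box, and every dyadic box comes from exactly one tuple. The bijection
  induced by \<open>\<alpha>\<close> sends \<open>x p\<close> to \<open>\<alpha>(x) p\<close>.

  This is well defined because tuples whose boxes meet have a common right multiple
  (\<open>word_act_meet\<close>), on which the morphism property fixes the value. It is defined everywhere, and
  onto, because a finitely generated right ideal is essential exactly if it contains all tuples with
  sufficiently long components (\<open>right_dense_fg_deep\<close>), and the boxes of the tuples of a given
  length tile the cube. The assignment is multiplicative. Two essential morphisms induce the same
  bijection iff they agree on all sufficiently long tuples, since a tuple is determined by its box;
  this is the minimum group congruence (\<open>sigma_eq_induced_map_kernel\<close>). Hence the group of
  classes is isomorphic to the group of induced bijections, and it remains to identify the latter
  with \<open>nV\<close>.

  An element of \<open>nV\<close> with patterns \<open>P\<close> and \<open>Q\<close> exchanges prefixes on every tuple that is longer than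
  all tuples describing \<open>P\<close>, and these tuples form an essential ideal; so it is induced by a morphism
  (\<open>brin_group_in_induced_map\<close>). Conversely, a morphism \<open>\<alpha>\<close> is defined on a grid of congruent small
  boxes. The image boxes tile the cube, but such a tiling need not be a dyadic pattern: the boxes
  \<open>x < 1/2 \<le> y\<close>, \<open>y < 1/2 \<le> z\<close>, \<open>z < 1/2 \<le> x\<close> and the two cubes left over tile the three-dimensional
  cube, and no halving of the cube respects them. The way out is to subdivide each
  box of the first grid by a grid of its own, chosen such that the image boxes become the cells of
  one common fine grid. The image is then a dyadic pattern because it is a grid, and the source is
  one because it refines a grid box by box (\<open>induced_map_in_brin_group\<close>).
\<close>

section \<open>Quotients by the kernel of a homomorphism\<close>

text \<open>
  The first isomorphism theorem. The quotient owes associativity and inverses to the group \<open>H\<close>: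
  both are pulled back along its injective map onto a subgroup.
\<close>

lemma quotient_by_kernel:
  fixes T :: "('a,'c) monoid_scheme" and H :: "('b,'d) monoid_scheme"
  assumes H: "group H" and F: "F \<in> hom T H"
    and closed: "\<And>x y. x \<in> carrier T \<Longrightarrow> y \<in> carrier T \<Longrightarrow> x \<otimes>\<^bsub>T\<^esub> y \<in> carrier T"
    and one: "\<one>\<^bsub>T\<^esub> \<in> carrier T"
    and sub: "subgroup (F ` carrier T) H"
    and r: "r = {(s, t). s \<in> carrier T \<and> t \<in> carrier T \<and> F s = F t}"
    and F_one: "F \<one>\<^bsub>T\<^esub> = \<one>\<^bsub>H\<^esub>"
  shows "group (quotient_monoid T r)"
    and "quotient_monoid T r \<cong> H\<lparr>carrier := F ` carrier T\<rparr>"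
proof -
  let ?Q = "quotient_monoid T r"
  define h where "h = (\<lambda>A. the_elem (F ` A))"
  have cls: "r `` {x} = {y \<in> carrier T. F y = F x}" if "x \<in> carrier T" for x
    using that by (auto simp: r)
  have h: "h (r `` {x}) = F x" if "x \<in> carrier T" for x
  proof -
    have "F ` (r `` {x}) = {F x}" using that by (auto simp: cls)
    then show ?thesis by (simp add: h_def)
  qed
  have carr: "carrier ?Q = (\<lambda>x. r `` {x}) ` carrier T"
    by (auto simp: quotient_monoid_def quotient_def)
  have mult: "(r `` {x}) \<otimes>\<^bsub>?Q\<^esub> (r `` {y}) = r `` {x \<otimes>\<^bsub>T\<^esub> y}"
    if "x \<in> carrier T" "y \<in> carrier T" for x y
  proof -
    have const: "r `` {a \<otimes>\<^bsub>T\<^esub> b} = r `` {x \<otimes>\<^bsub>T\<^esub> y}" if "a \<in> r `` {x}" "b \<in> r `` {y}" for a b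
      using that \<open>x \<in> carrier T\<close> \<open>y \<in> carrier T\<close> by (simp add: cls closed hom_mult[OF F])
    have ne: "r `` {x} \<noteq> {}" "r `` {y} \<noteq> {}" using that by (auto simp: cls)
    have "(r `` {x}) \<otimes>\<^bsub>?Q\<^esub> (r `` {y}) = (\<Union>a\<in>r `` {x}. \<Union>b\<in>r `` {y}. r `` {a \<otimes>\<^bsub>T\<^esub> b})"
      unfolding quotient_monoid_def set_mult_def by auto
    also have "\<dots> = (\<Union>a\<in>r `` {x}. \<Union>b\<in>r `` {y}. r `` {x \<otimes>\<^bsub>T\<^esub> y})"
      by (intro SUP_cong refl const)
    finally show ?thesis using ne by simp
  qed
  have oneQ: "\<one>\<^bsub>?Q\<^esub> = r `` {\<one>\<^bsub>T\<^esub>}" by (simp add: quotient_monoid_def)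
  have inj: "inj_on h (carrier ?Q)"
  proof (rule inj_onI)
    fix A B assume "A \<in> carrier ?Q" "B \<in> carrier ?Q" and eq: "h A = h B"
    then obtain x y where "x \<in> carrier T" "y \<in> carrier T" "A = r `` {x}" "B = r `` {y}"
      unfolding carr by blast
    with eq show "A = B" by (simp add: h) (simp add: cls)
  qed
  have img: "h ` carrier ?Q = F ` carrier T"
    unfolding carr image_image by (rule image_cong[OF refl h])
  have hmult: "h (A \<otimes>\<^bsub>?Q\<^esub> B) = h A \<otimes>\<^bsub>H\<^esub> h B" if AB: "A \<in> carrier ?Q" "B \<in> carrier ?Q" for A B
  proof -
    obtain x y where "x \<in> carrier T" "y \<in> carrier T" "A = r `` {x}" "B = r `` {y}"
      using AB unfolding carr by blast
    then show ?thesis by (simp add: mult h closed hom_mult[OF F])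
  qed
  have Qclosed: "A \<otimes>\<^bsub>?Q\<^esub> B \<in> carrier ?Q" if AB: "A \<in> carrier ?Q" "B \<in> carrier ?Q" for A B
  proof -
    obtain x y where "x \<in> carrier T" "y \<in> carrier T" "A = r `` {x}" "B = r `` {y}"
      using AB unfolding carr by blast
    then show ?thesis unfolding carr by (simp add: mult closed)
  qed
  interpret H: group H by fact
  have hH: "h A \<in> carrier H" if "A \<in> carrier ?Q" for A
    using that img subgroup.subset[OF sub] by blast
  have h1: "h \<one>\<^bsub>?Q\<^esub> = \<one>\<^bsub>H\<^esub>" by (simp add: oneQ h one F_one)
  have Q1: "\<one>\<^bsub>?Q\<^esub> \<in> carrier ?Q" using one by (simp add: oneQ carr)
  show "group ?Q"
  proof (rule groupI)
    fix A B C assume ABC: "A \<in> carrier ?Q" "B \<in> carrier ?Q" "C \<in> carrier ?Q"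
    then show "A \<otimes>\<^bsub>?Q\<^esub> B \<otimes>\<^bsub>?Q\<^esub> C = A \<otimes>\<^bsub>?Q\<^esub> (B \<otimes>\<^bsub>?Q\<^esub> C)"
      by (intro inj_onD[OF inj]) (simp_all add: Qclosed hmult hH H.m_assoc)
  next
    fix A assume A: "A \<in> carrier ?Q"
    then show "\<one>\<^bsub>?Q\<^esub> \<otimes>\<^bsub>?Q\<^esub> A = A"
      by (intro inj_onD[OF inj]) (simp_all add: Qclosed Q1 hmult h1 hH)
    have "inv\<^bsub>H\<^esub> h A \<in> h ` carrier ?Q"
      using A subgroup.m_inv_closed[OF sub] unfolding img[symmetric] by blast
    then obtain B where B: "B \<in> carrier ?Q" "h B = inv\<^bsub>H\<^esub> h A" by (metis imageE)
    then have "B \<otimes>\<^bsub>?Q\<^esub> A = \<one>\<^bsub>?Q\<^esub>"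
      using A by (intro inj_onD[OF inj]) (simp_all add: Qclosed Q1 hmult h1 hH)
    with B show "\<exists>B\<in>carrier ?Q. B \<otimes>\<^bsub>?Q\<^esub> A = \<one>\<^bsub>?Q\<^esub>" by blast
  qed (use Qclosed Q1 in auto)
  show "?Q \<cong> H\<lparr>carrier := F ` carrier T\<rparr>"
    using inj img hmult
    by (intro is_isoI[of h]) (auto simp: iso_def hom_def bij_betw_def)
qed

section \<open>Essential morphisms of a right Howson monoid\<close>

text \<open>
  The inverse of a partial bijection; the choice in it is unique if \<open>\<alpha>\<close> is injective on its domain.
\<close>

definition part_inv :: "('a \<rightharpoonup> 'b) \<Rightarrow> 'b \<rightharpoonup> 'a" where
  "part_inv \<alpha> b = (if b \<in> ran \<alpha> then Some (THE a. \<alpha> a = Some b) else None)"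

lemma inj_on_domD: "inj_on \<alpha> (dom \<alpha>) \<Longrightarrow> \<alpha> a = Some b \<Longrightarrow> \<alpha> a' = Some b \<Longrightarrow> a = a'"
  by (auto simp: inj_on_def dom_def)

lemma part_inv_eq_Some:
  assumes "inj_on \<alpha> (dom \<alpha>)"
  shows "part_inv \<alpha> b = Some a \<longleftrightarrow> \<alpha> a = Some b"
proof -
  have "(THE a. \<alpha> a = Some b) = a" if "\<alpha> a = Some b" for a
    using that inj_on_domD[OF assms] by blast
  then show ?thesis by (auto simp: part_inv_def ran_def)
qed

lemma restrict_comp_eq: "\<alpha> \<circ>\<^sub>m (Some |` I) = \<alpha> |` I"
  by (auto simp: map_comp_def restrict_map_def fun_eq_iff)

context monoid begin

text \<open>
  For finitely generated right ideals this is the property that makes the identity on \<open>I\<close> an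
  essential idempotent; it can be tested on single elements instead of ideals.
\<close>

definition right_dense :: "'a set \<Rightarrow> bool" where
  "right_dense I \<longleftrightarrow> (\<forall>y\<in>carrier G. \<exists>s\<in>carrier G. y \<otimes> s \<in> I)"

lemma fg_subset: "fg_right_ideal G I \<Longrightarrow> I \<subseteq> carrier G"
  by (auto simp: fg_right_ideal_def set_mult_def)

lemma fg_right_mult: "fg_right_ideal G I \<Longrightarrow> x \<in> I \<Longrightarrow> s \<in> carrier G \<Longrightarrow> x \<otimes> s \<in> I"
  unfolding fg_right_ideal_def set_mult_def by (force simp: m_assoc)

lemma fg_principal: "y \<in> carrier G \<Longrightarrow> fg_right_ideal G ({y} <#> carrier G)"
  unfolding fg_right_ideal_def by blast

lemma fg_carrier: "fg_right_ideal G (carrier G)"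
  using fg_principal[of \<one>] by (simp add: set_mult_def)

lemma fg_empty: "fg_right_ideal G {}"
  unfolding fg_right_ideal_def by (rule exI[of _ "{}"]) (simp add: set_mult_def)

text \<open>
  Images of generators generate the image. With \<open>J\<close> the whole domain this yields finite generation
  of the range when a partial map is to be recognised as a bijective morphism.
\<close>

lemma fg_morphic_image:
  assumes J: "fg_right_ideal G J" "J \<subseteq> dom \<alpha>" and ran: "ran \<alpha> \<subseteq> carrier G"
    and mor: "\<And>a b s. s \<in> carrier G \<Longrightarrow> \<alpha> a = Some b \<Longrightarrow> \<alpha> (a \<otimes> s) = Some (b \<otimes> s)"
  shows "fg_right_ideal G {b. \<exists>a\<in>J. \<alpha> a = Some b}"
proof -
  obtain X where X: "finite X" "X \<subseteq> carrier G" "J = X <#> carrier G"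
    using J(1) unfolding fg_right_ideal_def by blast
  have XJ: "X \<subseteq> J" using X(2) unfolding X(3) set_mult_def by (force intro: exI[of _ \<one>])
  let ?Y = "(\<lambda>x. the (\<alpha> x)) ` X"
  have X_val: "\<alpha> x = Some (the (\<alpha> x))" if "x \<in> X" for x
    using that XJ J(2) by (auto simp: dom_def)
  have val: "\<alpha> (x \<otimes> s) = Some (the (\<alpha> x) \<otimes> s)" if "x \<in> X" "s \<in> carrier G" for x s
    using that X_val mor by blast
  have "?Y \<subseteq> carrier G" using X_val ran by (force simp: ran_def)
  moreover have "{b. \<exists>a\<in>J. \<alpha> a = Some b} = ?Y <#> carrier G"
    unfolding X(3) set_mult_def by (auto simp: val)
  ultimately show ?thesis using X(1) unfolding fg_right_ideal_def by blast
qed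

lemma bij_morphism_inj: "bij_morphism G \<alpha> \<Longrightarrow> inj_on \<alpha> (dom \<alpha>)"
  and bij_morphism_dom: "bij_morphism G \<alpha> \<Longrightarrow> fg_right_ideal G (dom \<alpha>)"
  and bij_morphism_ran: "bij_morphism G \<alpha> \<Longrightarrow> fg_right_ideal G (ran \<alpha>)"
  and bij_morphism_mult: "bij_morphism G \<alpha> \<Longrightarrow> \<alpha> a = Some b \<Longrightarrow> s \<in> carrier G \<Longrightarrow>
    \<alpha> (a \<otimes> s) = Some (b \<otimes> s)"
  by (auto simp: bij_morphism_def)

lemma bij_morphism_closed:
  assumes "bij_morphism G \<alpha>" "\<alpha> a = Some b"
  shows "a \<in> carrier G" "b \<in> carrier G"
  using assms fg_subset bij_morphism_dom bij_morphism_ran by (blast intro: ranI)+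

lemma dom_part_inv: "dom (part_inv \<alpha>) = ran \<alpha>"
  by (auto simp: part_inv_def dom_def split: if_splits)

lemma ran_part_inv: "inj_on \<alpha> (dom \<alpha>) \<Longrightarrow> ran (part_inv \<alpha>) = dom \<alpha>"
  by (auto simp: ran_def part_inv_eq_Some)

lemma bij_morphism_part_inv:
  assumes "bij_morphism G \<alpha>"
  shows "bij_morphism G (part_inv \<alpha>)"
  unfolding bij_morphism_def
proof (intro conjI allI ballI impI)
  note inj = bij_morphism_inj[OF assms]
  show "fg_right_ideal G (dom (part_inv \<alpha>))" "fg_right_ideal G (ran (part_inv \<alpha>))"
    using assms by (simp_all add: dom_part_inv ran_part_inv inj bij_morphism_dom bij_morphism_ran)
  show "inj_on (part_inv \<alpha>) (dom (part_inv \<alpha>))"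

    by (rule inj_onI) (metis domIff not_None_eq option.inject part_inv_eq_Some[OF inj])
  show "part_inv \<alpha> (a \<otimes> s) = Some (b \<otimes> s)" if "s \<in> carrier G" "part_inv \<alpha> a = Some b" for a b s
    using that bij_morphism_mult[OF assms] by (simp add: part_inv_eq_Some[OF inj])
qed

lemma bij_morphism_restrict_id: "bij_morphism G (Some |` I)" if "fg_right_ideal G I"
proof -
  have "dom (Some |` I) = I" "ran (Some |` I) = I"
    by (auto simp: ran_def restrict_map_def dom_def split: if_splits)
  then show ?thesis
    using that by (auto simp: bij_morphism_def restrict_map_def fg_right_mult inj_on_def split: if_splits)
qed

lemma part_inv_comp: "part_inv \<alpha> \<circ>\<^sub>m \<alpha> = Some |` dom \<alpha>" if "inj_on \<alpha> (dom \<alpha>)"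
  by (auto simp: map_comp_def restrict_map_def fun_eq_iff part_inv_eq_Some[OF that] split: option.split)

lemma comp_part_inv: "\<alpha> \<circ>\<^sub>m part_inv \<alpha> = Some |` ran \<alpha>" if "inj_on \<alpha> (dom \<alpha>)"
proof
  fix b
  show "(\<alpha> \<circ>\<^sub>m part_inv \<alpha>) b = (Some |` ran \<alpha>) b"
    using part_inv_eq_Some[OF that, of b] dom_part_inv[of \<alpha>]
    by (cases "part_inv \<alpha> b") (auto simp: map_comp_def restrict_map_def)
qed

text \<open>
  If \<open>e\<close> is idempotent and \<open>e a = b\<close>, then \<open>e b = b\<close>, so injectivity forces \<open>a = b\<close>.
\<close>

lemma idems_R_monoid: "idems (R_monoid G) = {Some |` I | I. fg_right_ideal G I}"
proof (intro equalityI subsetI)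
  fix e assume "e \<in> idems (R_monoid G)"
  then have e: "bij_morphism G e" "e \<circ>\<^sub>m e = e"
    by (auto simp: idems_def R_monoid_def)
  have "e a = Some a" if "e a = Some b" for a b
  proof -
    have "e b = Some b" using fun_cong[OF e(2), of a] that by (simp add: map_comp_def)
    with that show ?thesis using inj_on_domD[OF bij_morphism_inj[OF e(1)]] by blast
  qed
  then have "e = Some |` dom e"
    by (auto simp: fun_eq_iff restrict_map_def domIff)
  then show "e \<in> {Some |` I | I. fg_right_ideal G I}"
    using bij_morphism_dom[OF e(1)] by blast
next
  fix e assume "e \<in> {Some |` I | I. fg_right_ideal G I}"
  then show "e \<in> idems (R_monoid G)"
    by (auto simp: idems_def R_monoid_def bij_morphism_restrict_id restrict_comp_eq)
qed

lemma sg_zero_R_monoid: "sg_zero (R_monoid G) = Map.empty"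
proof -
  have 0: "bij_morphism G Map.empty"
    using fg_empty by (simp add: bij_morphism_def)
  have "Map.empty \<circ>\<^sub>m x = Map.empty" for x :: "'a \<rightharpoonup> 'a"
    by (auto simp: map_comp_def split: option.split)
  with 0 show ?thesis
    unfolding sg_zero_def by (intro the_equality) (auto simp: R_monoid_def)
qed

text \<open>
  From \<open>s t s = s\<close> and injectivity, \<open>t\<close> undoes \<open>s\<close> on the domain of \<open>s\<close>; the equation
  \<open>t s t = t\<close> gives the same with the roles exchanged. Together they leave no other choice for \<open>t\<close>.
\<close>

lemma sg_inv_R_monoid:
  assumes s: "bij_morphism G s"
  shows "sg_inv (R_monoid G) s = part_inv s"
proof -
  note inj = bij_morphism_inj[OF s]
  have "t = part_inv s" if t: "bij_morphism G t" "s \<circ>\<^sub>m t \<circ>\<^sub>m s = s" "t \<circ>\<^sub>m s \<circ>\<^sub>m t = t" for t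
  proof -
    have aux: "v b = Some a" if u: "inj_on u (dom u)" "u \<circ>\<^sub>m v \<circ>\<^sub>m u = u" "u a = Some b" for u v :: "'a \<rightharpoonup> 'a" and a b
    proof -
      obtain c where c: "v b = Some c" "u c = Some b"
        using fun_cong[OF u(2), of a] u(3) by (auto simp: map_comp_def split: option.splits)
      then show ?thesis using inj_on_domD[OF u(1) c(2) u(3)] by simp
    qed
    have "t b = Some a \<longleftrightarrow> s a = Some b" for a b
      using aux[OF inj t(2)] aux[OF bij_morphism_inj[OF t(1)] t(3)] by blast
    then have "t b = Some a \<longleftrightarrow> part_inv s b = Some a" for a b
      by (simp add: part_inv_eq_Some[OF inj])
    then show ?thesis by (metis ext not_None_eq)
  qed
  moreover have "s \<circ>\<^sub>m part_inv s \<circ>\<^sub>m s = s" "part_inv s \<circ>\<^sub>m s \<circ>\<^sub>m part_inv s = part_inv s"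
    unfolding comp_part_inv[OF inj] part_inv_comp[OF inj]
    by (auto simp: map_comp_def fun_eq_iff restrict_map_def ranI
        part_inv_eq_Some[OF inj] eq_commute[of "Some _" "part_inv s _"] split: option.split)
  ultimately have "(THE t. bij_morphism G t \<and> s \<circ>\<^sub>m t \<circ>\<^sub>m s = s \<and> t \<circ>\<^sub>m s \<circ>\<^sub>m t = t) = part_inv s"
    using bij_morphism_part_inv[OF s] by (intro the_equality) blast+
  then show ?thesis by (simp add: sg_inv_def R_monoid_def)
qed

text \<open>
  Products of idempotents are identities on intersections. Density is necessary because it is the
  case of the principal ideals, and sufficient because every non-empty ideal contains one of them.
\<close>

lemma essential_idem_R_monoid:
  assumes "fg_right_ideal G I"
  shows "essential_idem (R_monoid G) (Some |` I) \<longleftrightarrow> right_dense I"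
proof -
  have restr: "(Some |` I) \<circ>\<^sub>m (Some |` J) = Some |` (I \<inter> J)" for J :: "'a set"
    by (auto simp: restrict_comp_eq)
  have empty: "Some |` J = Map.empty \<longleftrightarrow> J = {}" for J :: "'a set"
    by (auto simp: restrict_map_def fun_eq_iff split: if_splits)
  have "essential_idem (R_monoid G) (Some |` I) \<longleftrightarrow>
      I \<noteq> {} \<and> (\<forall>J. fg_right_ideal G J \<longrightarrow> J \<noteq> {} \<longrightarrow> I \<inter> J \<noteq> {})"
  proof -
    have "(\<forall>f\<in>idems (R_monoid G). P f) \<longleftrightarrow> (\<forall>J. fg_right_ideal G J \<longrightarrow> P (Some |` J))" for P
      unfolding idems_R_monoid by blast
    moreover have "Some |` I \<in> idems (R_monoid G)"
      using assms unfolding idems_R_monoid by blast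
    moreover have "\<alpha> \<otimes>\<^bsub>R_monoid G\<^esub> \<beta> = \<alpha> \<circ>\<^sub>m \<beta>" for \<alpha> \<beta>
      by (simp add: R_monoid_def)
    ultimately show ?thesis
      unfolding essential_idem_def sg_zero_R_monoid by (simp only: restr empty) simp
  qed
  also have "\<dots> \<longleftrightarrow> right_dense I"
  proof
    assume I: "I \<noteq> {} \<and> (\<forall>J. fg_right_ideal G J \<longrightarrow> J \<noteq> {} \<longrightarrow> I \<inter> J \<noteq> {})"
    show "right_dense I"
      unfolding right_dense_def
    proof
      fix y assume y: "y \<in> carrier G"
      then have "I \<inter> ({y} <#> carrier G) \<noteq> {}"
        using I fg_principal[OF y] by (auto simp: set_mult_def)
      then show "\<exists>s\<in>carrier G. y \<otimes> s \<in> I" by (auto simp: set_mult_def)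
    qed
  next
    assume "right_dense I"
    then show "I \<noteq> {} \<and> (\<forall>J. fg_right_ideal G J \<longrightarrow> J \<noteq> {} \<longrightarrow> I \<inter> J \<noteq> {})"
      unfolding right_dense_def using fg_right_mult fg_subset by blast
  qed
  finally show ?thesis .
qed

abbreviation essential_morphisms :: "('a \<rightharpoonup> 'a) monoid" where
  "essential_morphisms \<equiv> essential_part (R_monoid G)"

lemma carrier_essential_morphisms:
  "carrier essential_morphisms =
    {\<alpha>. bij_morphism G \<alpha> \<and> right_dense (dom \<alpha>) \<and> right_dense (ran \<alpha>)}"
proof -
  have "essential_idem (R_monoid G) (sg_inv (R_monoid G) s \<otimes>\<^bsub>R_monoid G\<^esub> s) \<longleftrightarrow> right_dense (dom s)"
    "essential_idem (R_monoid G) (s \<otimes>\<^bsub>R_monoid G\<^esub> sg_inv (R_monoid G) s) \<longleftrightarrow> right_dense (ran s)"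
    if s: "bij_morphism G s" for s
  proof -
    note inj = bij_morphism_inj[OF s]
    have "sg_inv (R_monoid G) s \<otimes>\<^bsub>R_monoid G\<^esub> s = Some |` dom s"
      "s \<otimes>\<^bsub>R_monoid G\<^esub> sg_inv (R_monoid G) s = Some |` ran s"
      unfolding sg_inv_R_monoid[OF s]
      by (simp_all add: R_monoid_def part_inv_comp[OF inj] comp_part_inv[OF inj])
    then show "essential_idem (R_monoid G) (sg_inv (R_monoid G) s \<otimes>\<^bsub>R_monoid G\<^esub> s) \<longleftrightarrow> right_dense (dom s)"
      "essential_idem (R_monoid G) (s \<otimes>\<^bsub>R_monoid G\<^esub> sg_inv (R_monoid G) s) \<longleftrightarrow> right_dense (ran s)"
      by (simp_all add: essential_idem_R_monoid bij_morphism_dom[OF s] bij_morphism_ran[OF s])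
  qed
  then show ?thesis
    unfolding essential_part_def by (auto simp: R_monoid_def)
qed

lemma mult_essential_morphisms [simp]: "\<alpha> \<otimes>\<^bsub>essential_morphisms\<^esub> \<beta> = \<alpha> \<circ>\<^sub>m \<beta>"
  and one_essential_morphisms [simp]: "\<one>\<^bsub>essential_morphisms\<^esub> = Some |` carrier G"
  by (simp_all add: essential_part_def R_monoid_def)

lemma part_inv_essential:
  assumes "\<alpha> \<in> carrier essential_morphisms"
  shows "part_inv \<alpha> \<in> carrier essential_morphisms"
  using assms by (simp add: carrier_essential_morphisms bij_morphism_part_inv dom_part_inv
      ran_part_inv bij_morphism_inj)

lemma restrict_id_essential:
  assumes "fg_right_ideal G I" "right_dense I"
  shows "Some |` I \<in> carrier essential_morphisms"
proof -
  have "dom (Some |` I) = I" "ran (Some |` I) = I"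
    by (auto simp: ran_def restrict_map_def dom_def split: if_splits)
  then show ?thesis
    using assms by (simp add: carrier_essential_morphisms bij_morphism_restrict_id)
qed

lemma right_dense_carrier: "right_dense (carrier G)"
  unfolding right_dense_def by blast

end

text \<open>
  The intersection property is what makes the bijective morphisms closed under composition:
  the composition of \<open>\<alpha>\<close> after \<open>\<beta>\<close> lives on the intersection of the domain of \<open>\<alpha>\<close> with the range
  of \<open>\<beta>\<close>.
\<close>

locale right_howson_monoid = monoid +
  assumes fg_Int: "fg_right_ideal G I \<Longrightarrow> fg_right_ideal G J \<Longrightarrow> fg_right_ideal G (I \<inter> J)"
begin

lemma bij_morphism_comp:
  assumes \<alpha>: "bij_morphism G \<alpha>" and \<beta>: "bij_morphism G \<beta>"
  shows "bij_morphism G (\<alpha> \<circ>\<^sub>m \<beta>)"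
  unfolding bij_morphism_def
proof (intro conjI allI ballI impI)
  let ?J = "dom \<alpha> \<inter> ran \<beta>"
  note inj\<beta> = bij_morphism_inj[OF \<beta>]
  have J: "fg_right_ideal G ?J"
    by (intro fg_Int bij_morphism_dom[OF \<alpha>] bij_morphism_ran[OF \<beta>])
  have "dom (\<alpha> \<circ>\<^sub>m \<beta>) = {a. \<exists>b\<in>?J. part_inv \<beta> b = Some a}"
    by (auto simp: part_inv_eq_Some[OF inj\<beta>] map_comp_def dom_def ran_def split: option.splits)
  also have "fg_right_ideal G \<dots>"
    using bij_morphism_part_inv[OF \<beta>] fg_subset[OF bij_morphism_dom[OF \<beta>]]
    by (intro fg_morphic_image J) (auto simp: dom_part_inv ran_part_inv[OF inj\<beta>] bij_morphism_mult)
  finally show "fg_right_ideal G (dom (\<alpha> \<circ>\<^sub>m \<beta>))" .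
  have "ran (\<alpha> \<circ>\<^sub>m \<beta>) = {c. \<exists>b\<in>?J. \<alpha> b = Some c}"
    by (auto simp: map_comp_def dom_def ran_def split: option.splits)
  also have "fg_right_ideal G \<dots>"
    using fg_subset[OF bij_morphism_ran[OF \<alpha>]]
    by (intro fg_morphic_image J) (auto simp: bij_morphism_mult[OF \<alpha>])
  finally show "fg_right_ideal G (ran (\<alpha> \<circ>\<^sub>m \<beta>))" .
  show "inj_on (\<alpha> \<circ>\<^sub>m \<beta>) (dom (\<alpha> \<circ>\<^sub>m \<beta>))"
  proof (rule inj_onI)
    fix a a' assume "a \<in> dom (\<alpha> \<circ>\<^sub>m \<beta>)" and eq: "(\<alpha> \<circ>\<^sub>m \<beta>) a = (\<alpha> \<circ>\<^sub>m \<beta>) a'"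
    then obtain c where "(\<alpha> \<circ>\<^sub>m \<beta>) a = Some c" by blast
    then obtain b b' where "\<beta> a = Some b" "\<alpha> b = Some c" "\<beta> a' = Some b'" "\<alpha> b' = Some c"
      using eq by (auto simp: map_comp_Some_iff)
    then show "a = a'"
      using inj_on_domD[OF inj\<beta>] inj_on_domD[OF bij_morphism_inj[OF \<alpha>]] by blast
  qed
  show "(\<alpha> \<circ>\<^sub>m \<beta>) (a \<otimes> s) = Some (c \<otimes> s)" if "s \<in> carrier G" "(\<alpha> \<circ>\<^sub>m \<beta>) a = Some c" for a c s
    using that bij_morphism_mult[OF \<alpha>] bij_morphism_mult[OF \<beta>]
    by (auto simp: map_comp_Some_iff)
qed

text \<open>
  Density of the domain and of the range of a composition both follow from one observation: if the
  domain of \<open>u\<close> is dense, then the preimage under \<open>u\<close> of a dense ideal is dense. For the range it is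
  applied to the inverse of \<open>\<alpha>\<close>.
\<close>

lemma essential_morphisms_closed:
  assumes \<alpha>: "\<alpha> \<in> carrier essential_morphisms" and \<beta>: "\<beta> \<in> carrier essential_morphisms"
  shows "\<alpha> \<circ>\<^sub>m \<beta> \<in> carrier essential_morphisms"
proof -
  have A: "bij_morphism G \<alpha>" "right_dense (dom \<alpha>)" "right_dense (ran \<alpha>)"
    and B: "bij_morphism G \<beta>" "right_dense (dom \<beta>)" "right_dense (ran \<beta>)"
    using assms by (auto simp: carrier_essential_morphisms)
  have dense: "\<exists>s\<in>carrier G. y \<otimes> s \<in> {a. \<exists>b. u a = Some b \<and> b \<in> J}"
    if u: "bij_morphism G u" "right_dense (dom u)" and J: "right_dense J" and y: "y \<in> carrier G" for u J y
  proof -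
    obtain s b where s: "s \<in> carrier G" "u (y \<otimes> s) = Some b"
      using u(2) y unfolding right_dense_def dom_def by blast
    obtain t where t: "t \<in> carrier G" "b \<otimes> t \<in> J"
      using J bij_morphism_closed(2)[OF u(1) s(2)] unfolding right_dense_def by blast
    have "u (y \<otimes> (s \<otimes> t)) = Some (b \<otimes> t)"
      using bij_morphism_mult[OF u(1) s(2) t(1)] s t y by (simp add: m_assoc)
    then show ?thesis using s t by blast
  qed
  have "right_dense (dom (\<alpha> \<circ>\<^sub>m \<beta>))"
    unfolding right_dense_def
  proof
    fix y assume "y \<in> carrier G"
    from dense[OF B(1,2) A(2) this] show "\<exists>s\<in>carrier G. y \<otimes> s \<in> dom (\<alpha> \<circ>\<^sub>m \<beta>)"
      by (auto simp: dom_def map_comp_Some_iff)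
  qed
  moreover have "right_dense (ran (\<alpha> \<circ>\<^sub>m \<beta>))"
    unfolding right_dense_def
  proof
    fix y assume y: "y \<in> carrier G"
    have "bij_morphism G (part_inv \<alpha>)" "right_dense (dom (part_inv \<alpha>))"
      using A by (simp_all add: bij_morphism_part_inv dom_part_inv)
    from dense[OF this B(3) y] show "\<exists>s\<in>carrier G. y \<otimes> s \<in> ran (\<alpha> \<circ>\<^sub>m \<beta>)"
      by (auto simp: part_inv_eq_Some[OF bij_morphism_inj[OF A(1)]] ran_def map_comp_Some_iff)
  qed
  ultimately show ?thesis
    using A B by (simp add: carrier_essential_morphisms bij_morphism_comp)
qed

text \<open>
  A common lower bound \<open>u\<close> of \<open>\<alpha>\<close> and \<open>\<beta>\<close> is a common restriction, and its domain is dense because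
  \<open>u\<close> is itself essential. Conversely the restriction to \<open>E\<close> is a lower bound.
\<close>

lemma sigma_essential_morphisms:
  "sigma_cong essential_morphisms =
    {(\<alpha>, \<beta>). \<alpha> \<in> carrier essential_morphisms \<and> \<beta> \<in> carrier essential_morphisms \<and>
      (\<exists>E. fg_right_ideal G E \<and> right_dense E \<and> E \<subseteq> dom \<alpha> \<and> E \<subseteq> dom \<beta> \<and> (\<forall>a\<in>E. \<alpha> a = \<beta> a))}"
    (is "_ = ?R")
proof -
  let ?T = essential_morphisms
  have idem: "Some |` E \<in> idems ?T" if "fg_right_ideal G E" "right_dense E" for E
    using that by (simp add: idems_def restrict_id_essential restrict_comp_eq)
  have le: "u a = \<alpha> a" if le: "natural_le ?T u \<alpha>" "a \<in> dom u" for u \<alpha> a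
  proof -
    obtain e where e: "e \<in> idems ?T" "u = \<alpha> \<circ>\<^sub>m e"
      using le(1) by (auto simp: natural_le_def)
    then have "e \<in> idems (R_monoid G)"
      by (auto simp: idems_def essential_part_def)
    then obtain I where "u = \<alpha> |` I"
      using e(2) by (auto simp: idems_R_monoid restrict_comp_eq)
    then show ?thesis using le(2) by (auto split: if_splits simp: restrict_map_def)
  qed
  show ?thesis
  proof (intro equalityI subsetI)
    fix x assume "x \<in> sigma_cong ?T"
    then obtain \<alpha> \<beta> u where x: "x = (\<alpha>, \<beta>)" "\<alpha> \<in> carrier ?T" "\<beta> \<in> carrier ?T"
      and u: "u \<in> carrier ?T" "natural_le ?T u \<alpha>" "natural_le ?T u \<beta>"
      by (auto simp: sigma_cong_def)
    have "fg_right_ideal G (dom u)" "right_dense (dom u)"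
      using u(1) by (auto simp: carrier_essential_morphisms bij_morphism_dom)
    moreover have "\<forall>a\<in>dom u. u a = \<alpha> a \<and> u a = \<beta> a"
      using le[OF u(2)] le[OF u(3)] by blast
    then have "dom u \<subseteq> dom \<alpha>" "dom u \<subseteq> dom \<beta>" "\<forall>a\<in>dom u. \<alpha> a = \<beta> a"
      unfolding dom_def by force+
    ultimately show "x \<in> ?R" using x by blast
  next
    fix x assume "x \<in> ?R"
    then obtain \<alpha> \<beta> E where x: "x = (\<alpha>, \<beta>)" "\<alpha> \<in> carrier ?T" "\<beta> \<in> carrier ?T"
      and E: "fg_right_ideal G E" "right_dense E" "\<forall>a\<in>E. \<alpha> a = \<beta> a" by blast
    have eq: "\<alpha> \<circ>\<^sub>m (Some |` E) = \<beta> \<circ>\<^sub>m (Some |` E)"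
      using E(3) unfolding restrict_comp_eq by (auto simp: restrict_map_def)
    have "\<alpha> \<circ>\<^sub>m (Some |` E) \<in> carrier ?T"
      using x(2) E by (simp add: essential_morphisms_closed restrict_id_essential)
    moreover have "natural_le ?T (\<alpha> \<circ>\<^sub>m (Some |` E)) \<alpha>" "natural_le ?T (\<alpha> \<circ>\<^sub>m (Some |` E)) \<beta>"
      unfolding natural_le_def mult_essential_morphisms using idem[OF E(1,2)] eq by blast+
    ultimately show "x \<in> sigma_cong ?T" using x by (auto simp: sigma_cong_def)
  qed
qed

end

section \<open>The action of a binary word on the unit interval\<close>

text \<open>
  The point of \<open>[0,1)\<close> whose binary expansion is \<open>w\<close> followed by that of \<open>t\<close>.
\<close>

primrec bits_act :: "bool list \<Rightarrow> real \<Rightarrow> real" where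
  "bits_act [] t = t"
| "bits_act (b # w) t = (of_bool b + bits_act w t) / 2"

lemma bits_act_append [simp]: "bits_act (u @ v) t = bits_act u (bits_act v t)"
  by (induction u) auto

lemma bits_act_affine: "bits_act w t = bits_act w 0 + t / 2 ^ length w"
  by (induction w) (simp, simp add: field_simps)

lemma bits_act_less: "bits_act w 0 < bits_act w 1"
  by (simp add: bits_act_affine[of w 1])

lemma bits_act_half: "bits_act w (1/2) = (bits_act w 0 + bits_act w 1) / 2"
  by (simp add: bits_act_affine[of w "1/2"] bits_act_affine[of w 1] field_simps)

lemma bits_act_inj [simp]: "bits_act w s = bits_act w t \<longleftrightarrow> s = t"
  by (induction w) auto

lemma bits_act_bounds: "0 \<le> t \<Longrightarrow> t < 1 \<Longrightarrow> 0 \<le> bits_act w t \<and> bits_act w t < 1"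
  by (induction w) auto

text \<open>
  Two dyadic intervals that meet are nested, that is, one of the words is a prefix of the other.
  The statement is symmetric in \<open>u\<close> and \<open>v\<close> so that it can be applied in each coordinate
  separately, where the prefix relation may go either way.
\<close>

lemma bits_act_meet:
  assumes "0 \<le> s" "s < 1" "0 \<le> t" "t < 1" "bits_act u s = bits_act v t"
  shows "\<exists>u' v' r. u @ u' = v @ v' \<and> 0 \<le> r \<and> r < 1 \<and> s = bits_act u' r \<and> t = bits_act v' r"
  using assms(5)
proof (induction u arbitrary: v)
  case Nil
  then show ?case using assms by (auto intro!: exI[of _ v] exI[of _ "[]"])
next
  case (Cons b u)
  show ?case
  proof (cases v)
    case Nil
    then show ?thesis using assms Cons.prems by (auto intro!: exI[of _ "b # u"] exI[of _ "[]"])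
  next
    case v: (Cons c v')
    have "0 \<le> bits_act u s" "bits_act u s < 1" "0 \<le> bits_act v' t" "bits_act v' t < 1"
      using bits_act_bounds assms by auto
    then have "b = c" "bits_act u s = bits_act v' t"
      using Cons.prems v by (cases b; cases c; simp)+
    with Cons.IH[of v'] v show ?thesis by auto
  qed
qed

lemma bits_act_digits:
  assumes "0 \<le> t" "t < 1"
  shows "\<exists>w r. length w = N \<and> 0 \<le> r \<and> r < 1 \<and> t = bits_act w r"
  using assms
proof (induction N arbitrary: t)
  case 0
  then show ?case by auto
next
  case (Suc N)
  define b where "b \<longleftrightarrow> t \<ge> 1/2"
  have "0 \<le> 2 * t - of_bool b" "2 * t - of_bool b < 1"
    using Suc.prems by (auto simp: b_def)
  from Suc.IH[OF this] obtain w r where "length w = N" "0 \<le> r" "r < 1" "2 * t - of_bool b = bits_act w r"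
    by blast
  then show ?case by (intro exI[of _ "b # w"] exI[of _ r]) (auto simp: field_simps)
qed

text \<open>
  The endpoints determine the length of the interval, hence the length of the word, and two words of
  equal length with meeting intervals are equal.
\<close>

lemma bits_act_faithful:
  assumes "bits_act u 0 = bits_act v 0" "bits_act u 1 = bits_act v 1"
  shows "u = v"
proof -
  have "(2::real) ^ length u = 2 ^ length v"
    using assms bits_act_affine[of u 1] bits_act_affine[of v 1] by simp
  then have "length u = length v" by simp
  moreover obtain u' v' where "u @ u' = v @ v'"
    using bits_act_meet[of 0 0 u v] assms(1) by auto
  ultimately show ?thesis by simp
qed

section \<open>Finitely generated right ideals of word tuples\<close>

context fixes n :: nat begin

abbreviation words :: "(nat \<Rightarrow> bool list) set" where
  "words \<equiv> carrier (A2_power n)"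

abbreviation word_mult :: "(nat \<Rightarrow> bool list) \<Rightarrow> (nat \<Rightarrow> bool list) \<Rightarrow> nat \<Rightarrow> bool list" (infixl "\<cdot>" 70) where
  "x \<cdot> y \<equiv> x \<otimes>\<^bsub>A2_power n\<^esub> y"

lemma words_eq: "words = (\<Pi>\<^sub>E i\<in>{..<n}. UNIV)"
  by (simp add: A2_power_def product_group_def free_monoid_def)

lemma word_mult_eq: "x \<cdot> y = (\<lambda>i\<in>{..<n}. x i @ y i)"
  by (simp add: A2_power_def product_group_def free_monoid_def)

lemma words_restrict [simp]: "(\<lambda>i\<in>{..<n}. w i) \<in> words"
  by (simp add: words_eq)

lemma word_mult_apply [simp]: "i < n \<Longrightarrow> (x \<cdot> y) i = x i @ y i"
  by (simp add: word_mult_eq)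

lemma words_eqI: "x \<in> words \<Longrightarrow> y \<in> words \<Longrightarrow> (\<And>i. i < n \<Longrightarrow> x i = y i) \<Longrightarrow> x = y"
  unfolding words_eq by (rule PiE_ext) auto

lemma word_mult_closed [simp]: "x \<cdot> y \<in> words"
  by (simp add: word_mult_eq)

lemma one_A2_power: "\<one>\<^bsub>A2_power n\<^esub> = (\<lambda>i\<in>{..<n}. [])"
  by (simp add: A2_power_def product_group_def free_monoid_def)

lemma monoid_A2_power: "monoid (A2_power n)"
  by (rule monoidI) (auto simp: one_A2_power intro!: words_eqI)

interpretation monoid "A2_power n" by (rule monoid_A2_power)

definition word_take :: "nat \<Rightarrow> (nat \<Rightarrow> bool list) \<Rightarrow> nat \<Rightarrow> bool list" where
  "word_take M x = (\<lambda>i\<in>{..<n}. take M (x i))"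

definition word_drop :: "nat \<Rightarrow> (nat \<Rightarrow> bool list) \<Rightarrow> nat \<Rightarrow> bool list" where
  "word_drop M x = (\<lambda>i\<in>{..<n}. drop M (x i))"

lemma word_take_drop: "x \<in> words \<Longrightarrow> word_take M x \<cdot> word_drop M x = x"
  by (intro words_eqI) (auto simp: word_take_def word_drop_def)

lemma word_take_closed [simp]: "word_take M x \<in> words" "word_drop M x \<in> words"
  by (simp_all add: word_take_def word_drop_def)

lemma finite_short_words: "finite {x \<in> words. \<forall>i<n. length (x i) \<le> M}"
proof -
  have "finite {w :: bool list. length w \<le> M}"
    using finite_lists_length_le[of "UNIV :: bool set" M] by simp
  then have "finite (\<Pi>\<^sub>E i\<in>{..<n}. {w :: bool list. length w \<le> M})"
    by (intro finite_PiE) auto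
  then show ?thesis
    by (rule finite_subset[rotated]) (auto simp: words_eq PiE_def Pi_def)
qed

text \<open>
  Truncating at the maximal length \<open>M\<close> of a generator does not leave the ideal, and conversely an
  ideal that is stable under truncation at \<open>M\<close> is generated by its elements of length at most \<open>M\<close>.
  In this form finite generation is visibly stable under intersection.
\<close>

lemma fg_right_ideal_iff:
  "fg_right_ideal (A2_power n) I \<longleftrightarrow>
    I \<subseteq> words \<and> (\<forall>x\<in>I. \<forall>s\<in>words. x \<cdot> s \<in> I) \<and> (\<exists>M. \<forall>x\<in>I. word_take M x \<in> I)"
proof (intro iffI conjI)
  assume I: "fg_right_ideal (A2_power n) I"
  then show "I \<subseteq> words" "\<forall>x\<in>I. \<forall>s\<in>words. x \<cdot> s \<in> I"
    using fg_subset fg_right_mult by blast+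
  obtain X where X: "finite X" "X \<subseteq> words" "I = X <#>\<^bsub>A2_power n\<^esub> words"
    using I unfolding fg_right_ideal_def by blast
  \<comment> \<open>Inserting \<open>0\<close> keeps the maximum meaningful if there are no generators.\<close>
  define M where "M = Max (insert 0 ((\<lambda>(x, i). length (x i)) ` (X \<times> {..<n})))"
  have M: "length (x i) \<le> M" if "x \<in> X" "i < n" for x i
    unfolding M_def using X(1) that by (intro Max_ge) force+
  show "\<exists>M. \<forall>x\<in>I. word_take M x \<in> I"
  proof (intro exI ballI)
    fix z assume "z \<in> I"
    then obtain x s where z: "x \<in> X" "s \<in> words" "z = x \<cdot> s"
      by (auto simp: X(3) set_mult_def)
    have "word_take M z = x \<cdot> (\<lambda>i\<in>{..<n}. take (M - length (x i)) (s i))"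
      using z M[OF z(1)] X(2) by (intro words_eqI) (auto simp: word_take_def)
    then show "word_take M z \<in> I"
      unfolding X(3) set_mult_def using z(1) words_restrict by blast
  qed
next
  assume I: "I \<subseteq> words \<and> (\<forall>x\<in>I. \<forall>s\<in>words. x \<cdot> s \<in> I) \<and> (\<exists>M. \<forall>x\<in>I. word_take M x \<in> I)"
  then obtain M where M: "\<And>x. x \<in> I \<Longrightarrow> word_take M x \<in> I" by blast
  let ?X = "{x \<in> I. \<forall>i<n. length (x i) \<le> M}"
  have "finite ?X" by (rule finite_subset[OF _ finite_short_words[of M]]) (use I in auto)
  moreover have "I = ?X <#>\<^bsub>A2_power n\<^esub> words"
  proof (intro equalityI subsetI)
    fix z assume z: "z \<in> I"
    then have "word_take M z \<in> ?X" using M by (auto simp: word_take_def)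
    moreover have "z = word_take M z \<cdot> word_drop M z"
      using z I by (intro word_take_drop[symmetric]) blast
    ultimately show "z \<in> ?X <#>\<^bsub>A2_power n\<^esub> words"
      unfolding set_mult_def using word_take_closed(2) by blast
  next
    fix z assume "z \<in> ?X <#>\<^bsub>A2_power n\<^esub> words"
    then show "z \<in> I" using I by (auto simp: set_mult_def)
  qed
  ultimately show "fg_right_ideal (A2_power n) I"
    unfolding fg_right_ideal_def using I by (intro exI[of _ ?X]) auto
qed

lemma word_take_mono:
  assumes "\<forall>x\<in>I. \<forall>s\<in>words. x \<cdot> s \<in> I" "word_take M x \<in> I" "M \<le> M'"
  shows "word_take M' x \<in> I"
proof -
  have "take M' w = take M w @ drop M (take M' w)" for w :: "bool list"
    using append_take_drop_id[of M "take M' w"] assms(3) by (simp add: min_absorb1)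
  then have "word_take M' x = word_take M x \<cdot> (\<lambda>i\<in>{..<n}. drop M (take M' (x i)))"
    by (intro words_eqI) (simp_all add: word_take_def)
  then show ?thesis
    by (rule ssubst) (rule assms(1)[rule_format, OF assms(2) words_restrict])
qed

lemma right_howson_A2_power: "right_howson_monoid (A2_power n)"
proof
  fix I J assume "fg_right_ideal (A2_power n) I" "fg_right_ideal (A2_power n) J"
  then obtain M M' where I: "I \<subseteq> words" "\<forall>x\<in>I. \<forall>s\<in>words. x \<cdot> s \<in> I" "\<forall>x\<in>I. word_take M x \<in> I"
    and J: "J \<subseteq> words" "\<forall>x\<in>J. \<forall>s\<in>words. x \<cdot> s \<in> J" "\<forall>x\<in>J. word_take M' x \<in> J"
    unfolding fg_right_ideal_iff by blast
  have "\<forall>x\<in>I \<inter> J. word_take (max M M') x \<in> I \<inter> J"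
    using word_take_mono[OF I(2), of M _ "max M M'"] word_take_mono[OF J(2), of M' _ "max M M'"] I(3) J(3)
    by auto
  then show "fg_right_ideal (A2_power n) (I \<inter> J)"
    unfolding fg_right_ideal_iff using I J by blast
qed

interpretation right_howson_monoid "A2_power n" by (rule right_howson_A2_power)

text \<open>
  The tuples that have a prefix in the grid of depth \<open>N\<close>. Every essential
  finitely generated ideal contains one of these.
\<close>

definition deep_words :: "nat \<Rightarrow> (nat \<Rightarrow> bool list) set" where
  "deep_words N = {x \<in> words. \<forall>i<n. N \<le> length (x i)}"

lemma fg_deep_words: "fg_right_ideal (A2_power n) (deep_words N)"
  unfolding fg_right_ideal_iff
  by (auto simp: deep_words_def word_take_def trans_le_add1 intro!: exI[of _ N])

lemma right_dense_deep_words: "right_dense (deep_words N)"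
  unfolding right_dense_def
proof
  fix y assume "y \<in> words"
  have "y \<cdot> (\<lambda>i\<in>{..<n}. replicate N False) \<in> deep_words N" by (auto simp: deep_words_def)
  then show "\<exists>s\<in>words. y \<cdot> s \<in> deep_words N" using words_restrict by blast
qed

lemma deep_words_antimono: "N \<le> M \<Longrightarrow> deep_words M \<subseteq> deep_words N"
  by (auto simp: deep_words_def)

text \<open>
  Let \<open>I\<close> be stable under truncation at \<open>M\<close>. If \<open>y\<close> is at least \<open>M\<close> long in each component, then
  \<open>y\<close> and its extension \<open>y s \<in> I\<close> have the same truncation, which therefore lies in \<open>I\<close>; so does
  its extension \<open>y\<close>.
\<close>

lemma right_dense_fg_deep:
  assumes "fg_right_ideal (A2_power n) I" "right_dense I"
  obtains N where "deep_words N \<subseteq> I"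
proof -
  obtain M where M: "\<And>x. x \<in> I \<Longrightarrow> word_take M x \<in> I"
    and I: "\<And>x s. x \<in> I \<Longrightarrow> s \<in> words \<Longrightarrow> x \<cdot> s \<in> I"
    using assms(1) unfolding fg_right_ideal_iff by blast
  have "deep_words M \<subseteq> I"
  proof
    fix y assume y: "y \<in> deep_words M"
    then have yw: "y \<in> words" by (simp add: deep_words_def)
    then obtain s where s: "s \<in> words" "y \<cdot> s \<in> I" using assms(2) unfolding right_dense_def by blast
    have "word_take M (y \<cdot> s) = word_take M y"
      using y by (intro words_eqI) (auto simp: word_take_def deep_words_def)
    then have "word_take M y \<in> I" using M[OF s(2)] by simp
    from I[OF this, of "word_drop M y"] show "y \<in> I" by (simp add: word_take_drop[OF yw])
  qed
  then show ?thesis by (rule that)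
qed

section \<open>The action of word tuples on the cube\<close>

abbreviation cube :: "(nat \<Rightarrow> real) set" where "cube \<equiv> unit_cube n"

definition word_act :: "(nat \<Rightarrow> bool list) \<Rightarrow> (nat \<Rightarrow> real) \<Rightarrow> nat \<Rightarrow> real" where
  "word_act x p = (\<lambda>i\<in>{..<n}. bits_act (x i) (p i))"

lemma word_act_apply [simp]: "i < n \<Longrightarrow> word_act x p i = bits_act (x i) (p i)"
  by (simp add: word_act_def)

lemma hbox_iff: "p \<in> hbox n a b \<longleftrightarrow> p \<in> extensional {..<n} \<and> (\<forall>i<n. a i \<le> p i \<and> p i < b i)"
  by (auto simp: hbox_def PiE_def Pi_def)

lemmas cube_iff = hbox_iff[of _ "\<lambda>_. 0" "\<lambda>_. 1"]

lemma cube_eqI: "p \<in> cube \<Longrightarrow> q \<in> cube \<Longrightarrow> (\<And>i. i < n \<Longrightarrow> p i = q i) \<Longrightarrow> p = q"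
  unfolding hbox_def by (rule PiE_ext) auto

lemma word_act_cube [simp]: "p \<in> cube \<Longrightarrow> word_act x p \<in> cube"
  by (auto simp: cube_iff word_act_def bits_act_bounds)

lemma word_act_mult: "word_act (x \<cdot> y) p = word_act x (word_act y p)"
  by (auto simp: word_act_def word_mult_eq restrict_def fun_eq_iff)

lemma word_act_inj: "p \<in> cube \<Longrightarrow> q \<in> cube \<Longrightarrow> word_act x p = word_act x q \<Longrightarrow> p = q"
  by (erule cube_eqI, assumption) (metis word_act_apply bits_act_inj)

lemma origin_cube [simp]: "(\<lambda>i\<in>{..<n}. 0) \<in> cube"
  by (simp add: cube_iff)

lemma word_act_meet:
  assumes "p \<in> cube" "q \<in> cube" "word_act x p = word_act y q"
  obtains s t r where "s \<in> words" "t \<in> words" "r \<in> cube"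
    "x \<cdot> s = y \<cdot> t" "p = word_act s r" "q = word_act t r"
proof -
  have "\<exists>u v r. x i @ u = y i @ v \<and> 0 \<le> r \<and> r < 1 \<and> p i = bits_act u r \<and> q i = bits_act v r"
    if i: "i < n" for i
  proof -
    have "bits_act (x i) (p i) = bits_act (y i) (q i)"
      using fun_cong[OF assms(3), of i] i by simp
    then show ?thesis
      using bits_act_meet[of "p i" "q i" "x i" "y i"] assms(1,2) i by (simp add: cube_iff)
  qed
  then obtain u v r where uvr: "\<And>i. i < n \<Longrightarrow> x i @ u i = y i @ v i \<and> 0 \<le> r i \<and> r i < 1 \<and>
      p i = bits_act (u i) (r i) \<and> q i = bits_act (v i) (r i)"
    by metis
  have r: "(\<lambda>i\<in>{..<n}. r i) \<in> cube" using uvr by (simp add: cube_iff)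
  show ?thesis
  proof (rule that[of "\<lambda>i\<in>{..<n}. u i" "\<lambda>i\<in>{..<n}. v i" "\<lambda>i\<in>{..<n}. r i"])
    show "p = word_act (\<lambda>i\<in>{..<n}. u i) (\<lambda>i\<in>{..<n}. r i)" "q = word_act (\<lambda>i\<in>{..<n}. v i) (\<lambda>i\<in>{..<n}. r i)"
      using uvr assms(1,2) r by (auto intro!: cube_eqI)
    show "x \<cdot> (\<lambda>i\<in>{..<n}. u i) = y \<cdot> (\<lambda>i\<in>{..<n}. v i)"
      using uvr by (intro words_eqI) simp_all
  qed (use r in auto)
qed

lemma cube_digits:
  assumes "p \<in> cube"
  obtains x r where "x \<in> words" "\<And>i. i < n \<Longrightarrow> length (x i) = k i" "r \<in> cube" "p = word_act x r"
proof -
  have "\<exists>w r. length w = k i \<and> 0 \<le> r \<and> r < 1 \<and> p i = bits_act w r" if "i < n" for i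
    using bits_act_digits[of "p i" "k i"] assms that by (auto simp: cube_iff)
  then obtain w r where wr: "\<And>i. i < n \<Longrightarrow> length (w i) = k i \<and> 0 \<le> r i \<and> r i < 1 \<and> p i = bits_act (w i) (r i)"
    by metis
  have r: "(\<lambda>i\<in>{..<n}. r i) \<in> cube" using wr by (simp add: cube_iff)
  then show ?thesis
    using wr assms by (intro that[of "\<lambda>i\<in>{..<n}. w i" "\<lambda>i\<in>{..<n}. r i"]) (auto intro!: cube_eqI)
qed

definition box :: "(nat \<Rightarrow> bool list) \<Rightarrow> (nat \<Rightarrow> real) set" where
  "box x = word_act x ` cube"

text \<open>
  Both a box of a word tuple and the image of such a box under a coordinatewise increasing affine map
  are of this form.
\<close>

lemma affine_image_cube:
  assumes "\<And>i. i < n \<Longrightarrow> d i > 0"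
  shows "(\<lambda>p. \<lambda>i\<in>{..<n}. c i + d i * p i) ` cube = hbox n c (\<lambda>i. c i + d i)"
proof (intro equalityI subsetI)
  fix q assume "q \<in> (\<lambda>p. \<lambda>i\<in>{..<n}. c i + d i * p i) ` cube"
  then obtain p where p: "p \<in> cube" "q = (\<lambda>i\<in>{..<n}. c i + d i * p i)" by blast
  have "0 \<le> d i * p i \<and> d i * p i < d i * 1" if "i < n" for i
    using p(1) that assms[OF that] unfolding cube_iff by (intro conjI mult_strict_left_mono) auto
  then show "q \<in> hbox n c (\<lambda>i. c i + d i)"
    by (simp add: p(2) hbox_iff)
next
  fix q assume q: "q \<in> hbox n c (\<lambda>i. c i + d i)"
  let ?p = "\<lambda>i\<in>{..<n}. (q i - c i) / d i"
  have d: "d i > 0" "d i \<noteq> 0" if "i < n" for i using assms[OF that] by auto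
  have "?p \<in> cube"
    using q d(1) unfolding hbox_iff by (auto simp: divide_less_eq)
  moreover have "q = (\<lambda>i\<in>{..<n}. c i + d i * ?p i)"
    by (rule extensionalityI[of _ "{..<n}"]) (use q d(2) in \<open>auto simp: hbox_iff\<close>)
  ultimately show "q \<in> (\<lambda>p. \<lambda>i\<in>{..<n}. c i + d i * p i) ` cube" by blast
qed

lemma box_eq_hbox: "box x = hbox n (\<lambda>i. bits_act (x i) 0) (\<lambda>i. bits_act (x i) 1)"
proof -
  have "word_act x = (\<lambda>p. \<lambda>i\<in>{..<n}. bits_act (x i) 0 + 1 / 2 ^ length (x i) * p i)"
    by (auto simp: word_act_def bits_act_affine[of _ "_ _"] fun_eq_iff restrict_def)
  then have "box x = hbox n (\<lambda>i. bits_act (x i) 0) (\<lambda>i. bits_act (x i) 0 + 1 / 2 ^ length (x i))"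
    unfolding box_def using affine_image_cube[of "\<lambda>i. 1 / 2 ^ length (x i)"] by simp
  then show ?thesis by (simp add: bits_act_affine[of _ 1, symmetric])
qed

lemma hbox_cong: "(\<And>i. i < n \<Longrightarrow> a i = a' i \<and> b i = b' i) \<Longrightarrow> hbox n a b = hbox n a' b'"
  unfolding hbox_def by (rule PiE_cong) auto

lemma hbox_inj:
  assumes "hbox n a b = hbox n a' b'" "\<And>i. i < n \<Longrightarrow> a i < b i" "hbox n a' b' \<noteq> {}" "i < n"
  shows "a i = a' i" "b i = b' i"
proof -
  have lt: "a' i < b' i" if "i < n" for i
    using assms(3) that unfolding hbox_def by (metis PiE_eq_empty_iff atLeastLessThan_empty_iff lessThan_iff)
  have "\<forall>i\<in>{..<n}. {a i..<b i} = {a' i..<b' i}"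
    using assms(1,2) lt unfolding hbox_def by (subst (asm) PiE_eq_iff_not_empty) auto
  then show "a i = a' i" "b i = b' i"
    using assms(2,4) lt by (auto simp: atLeastLessThan_eq_iff)
qed

lemma box_nonempty: "box x \<noteq> {}"
  unfolding box_def using origin_cube by blast

lemma hbox_eq_box:
  assumes "hbox n a b = box x" "i < n"
  shows "a i = bits_act (x i) 0" "b i = bits_act (x i) 1"
  using hbox_inj[of "\<lambda>i. bits_act (x i) 0" "\<lambda>i. bits_act (x i) 1" a b i] assms bits_act_less
    box_nonempty[of x] by (auto simp: box_eq_hbox)

lemma box_inj:
  assumes "x \<in> words" "y \<in> words" "box x = box y"
  shows "x = y"
  using assms(1,2)
proof (rule words_eqI)
  fix i assume "i < n"
  then show "x i = y i"
    using hbox_eq_box[of _ _ y i, OF assms(3)[unfolded box_eq_hbox[of x]]]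
    by (intro bits_act_faithful) auto
qed

lemma word_act_faithful:
  assumes "x \<in> words" "y \<in> words" "\<And>p. p \<in> cube \<Longrightarrow> word_act x p = word_act y p"
  shows "x = y"
  by (rule box_inj) (use assms in \<open>auto simp: box_def\<close>)

lemma box_mult_subset: "box (x \<cdot> s) \<subseteq> box x"
  by (auto simp: box_def word_act_mult)

text \<open>
  An increasing affine map between two boxes is determined by the endpoints in each coordinate, so
  the affine map from the box of \<open>x\<close> to that of \<open>y\<close> is the exchange of the prefix \<open>x\<close> for \<open>y\<close>.
\<close>

lemma affine_box_map_iff:
  "affine_box_map n f (box x) (box y) \<longleftrightarrow> (\<forall>p\<in>cube. f (word_act x p) = word_act y p)"
proof
  assume "affine_box_map n f (box x) (box y)"
  then obtain s t where img: "f ` box x = box y" and s: "\<And>i. i < n \<Longrightarrow> s i > 0"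
    and f: "\<And>q. q \<in> box x \<Longrightarrow> f q = (\<lambda>i\<in>{..<n}. s i * q i + t i)"
    unfolding affine_box_map_def by blast
  define c where "c i = s i * bits_act (x i) 0 + t i" for i
  define d where "d i = s i / 2 ^ length (x i)" for i
  have fx: "f (word_act x p) = (\<lambda>i\<in>{..<n}. c i + d i * p i)" if "p \<in> cube" for p
  proof -
    have "s i * bits_act (x i) r + t i = c i + d i * r" for i r
      by (subst bits_act_affine) (simp add: c_def d_def field_simps)
    moreover have "word_act x p \<in> box x" using that by (simp add: box_def)
    ultimately show ?thesis by (auto simp: f restrict_def fun_eq_iff)
  qed
  have "box y = (\<lambda>p. f (word_act x p)) ` cube"
    using img by (simp add: box_def image_image)
  also have "\<dots> = (\<lambda>p. \<lambda>i\<in>{..<n}. c i + d i * p i) ` cube"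
    by (rule image_cong[OF refl fx])
  also have "\<dots> = hbox n c (\<lambda>i. c i + d i)"
    using s by (intro affine_image_cube) (simp add: d_def)
  finally have box_y: "box y = hbox n c (\<lambda>i. c i + d i)" .
  have c: "c i = bits_act (y i) 0" and cd: "c i + d i = bits_act (y i) 1" if "i < n" for i
    using hbox_eq_box[OF sym[OF box_y] that] .
  have "c i + d i * r = bits_act (y i) r" if "i < n" for i r
  proof -
    have "d i = 1 / 2 ^ length (y i)"
      using c[OF that] cd[OF that] bits_act_affine[of "y i" 1] by simp
    then show ?thesis using c[OF that] bits_act_affine[of "y i" r] by simp
  qed
  then show "\<forall>p\<in>cube. f (word_act x p) = word_act y p"
    by (simp add: fx) (simp add: word_act_def restrict_def fun_eq_iff)
next
  assume f: "\<forall>p\<in>cube. f (word_act x p) = word_act y p"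
  let ?s = "\<lambda>i. 2 ^ length (x i) / 2 ^ length (y i) :: real"
  have "f q = (\<lambda>i\<in>{..<n}. ?s i * q i + (bits_act (y i) 0 - ?s i * bits_act (x i) 0))" if q: "q \<in> box x" for q
  proof -
    obtain p where p: "q = word_act x p" "f q = word_act y p" using q f by (auto simp: box_def)
    have eq: "bits_act (y i) r = ?s i * bits_act (x i) r + (bits_act (y i) 0 - ?s i * bits_act (x i) 0)" for i r
    proof -
      have "bits_act (x i) r - bits_act (x i) 0 = r / 2 ^ length (x i)"
        using bits_act_affine[of "x i" r] by linarith
      then have "?s i * (bits_act (x i) r - bits_act (x i) 0) = r / 2 ^ length (y i)"
        by (simp only:) simp
      then show ?thesis
        using bits_act_affine[of "y i" r] unfolding right_diff_distrib by linarith
    qed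
    show ?thesis
      unfolding p(2) unfolding p(1) word_act_def[of y] by (rule restrict_ext) (subst eq, simp)
  qed
  moreover have "f ` box x = box y" using f by (force simp: box_def)
  ultimately show "affine_box_map n f (box x) (box y)"
    unfolding affine_box_map_def
    by (intro conjI exI[of _ ?s] exI[of _ "\<lambda>i. bits_act (y i) 0 - ?s i * bits_act (x i) 0"]) auto
qed

section \<open>The bijection of the cube induced by a morphism\<close>

abbreviation word_morphisms :: "((nat \<Rightarrow> bool list) \<rightharpoonup> (nat \<Rightarrow> bool list)) monoid" where
  "word_morphisms \<equiv> essential_part (R_monoid (A2_power n))"

definition induced_map ::
    "((nat \<Rightarrow> bool list) \<rightharpoonup> (nat \<Rightarrow> bool list)) \<Rightarrow> (nat \<Rightarrow> real) \<Rightarrow> nat \<Rightarrow> real" where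
  "induced_map \<alpha> = (\<lambda>q\<in>cube. THE r. \<exists>a b p. \<alpha> a = Some b \<and> p \<in> cube \<and>
     q = word_act a p \<and> r = word_act b p)"

text \<open>
  If \<open>a s = a' t\<close> then \<open>\<alpha>(a) s = \<alpha>(a s) = \<alpha>(a' t) = \<alpha>(a') t\<close>, and the two points in question arise
  by letting these equal tuples act on the same point.
\<close>

lemma word_act_morphism_cong:
  assumes "bij_morphism (A2_power n) \<alpha>" "\<alpha> a = Some b" "\<alpha> a' = Some b'"
    and "p \<in> cube" "p' \<in> cube" "word_act a p = word_act a' p'"
  shows "word_act b p = word_act b' p'"
proof -
  obtain s t r where st: "s \<in> words" "t \<in> words" "a \<cdot> s = a' \<cdot> t"
    and r: "p = word_act s r" "p' = word_act t r"
    using word_act_meet[OF assms(4-6)] by metis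
  have "b \<cdot> s = b' \<cdot> t"
    using bij_morphism_mult[OF assms(1,2) st(1)] bij_morphism_mult[OF assms(1,3) st(2)] st(3) by simp
  then show ?thesis unfolding r word_act_mult[symmetric] by simp
qed

lemma induced_map_word_act:
  assumes "bij_morphism (A2_power n) \<alpha>" "\<alpha> a = Some b" "p \<in> cube"
  shows "induced_map \<alpha> (word_act a p) = word_act b p"
proof -
  have "(THE r. \<exists>a' b' p'. \<alpha> a' = Some b' \<and> p' \<in> cube \<and>
      word_act a p = word_act a' p' \<and> r = word_act b' p') = word_act b p"
    using assms(2,3) by (intro the_equality)
      (blast, blast intro: word_act_morphism_cong[OF assms(1) _ assms(2) _ assms(3) sym])
  then show ?thesis using assms(3) by (simp add: induced_map_def)
qed

lemma deep_words_cover: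
  assumes "q \<in> cube"
  obtains a p where "a \<in> deep_words N" "p \<in> cube" "q = word_act a p"
  by (rule cube_digits[OF assms, of "\<lambda>_. N"]) (auto simp: deep_words_def intro: that)

lemma dense_ideal_cover:
  assumes "fg_right_ideal (A2_power n) I" "right_dense I" "q \<in> cube"
  obtains a p where "a \<in> I" "p \<in> cube" "q = word_act a p"
proof -
  obtain N where N: "deep_words N \<subseteq> I" using right_dense_fg_deep[OF assms(1,2)] .
  obtain a p where "a \<in> deep_words N" "p \<in> cube" "q = word_act a p"
    using deep_words_cover[OF assms(3)] .
  then show ?thesis using N by (intro that) auto
qed

lemma word_morphismD:
  assumes "\<alpha> \<in> carrier word_morphisms"
  shows "bij_morphism (A2_power n) \<alpha>" "fg_right_ideal (A2_power n) (dom \<alpha>)" "right_dense (dom \<alpha>)"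
  using assms bij_morphism_dom by (auto simp: carrier_essential_morphisms)

lemma morphism_cover:
  assumes "\<alpha> \<in> carrier word_morphisms" "q \<in> cube"
  obtains a b p where "\<alpha> a = Some b" "p \<in> cube" "q = word_act a p"
  by (rule dense_ideal_cover[OF word_morphismD(2,3)[OF assms(1)] assms(2)]) (auto intro: that)

lemma induced_map_cube:
  assumes "\<alpha> \<in> carrier word_morphisms" "q \<in> cube"
  shows "induced_map \<alpha> q \<in> cube"
  by (rule morphism_cover[OF assms])
    (simp add: induced_map_word_act[OF word_morphismD(1)[OF assms(1)]] del: word_act_apply)

lemma induced_map_part_inv:
  assumes "\<alpha> \<in> carrier word_morphisms" "q \<in> cube"
  shows "induced_map (part_inv \<alpha>) (induced_map \<alpha> q) = q"
    and "induced_map \<alpha> (induced_map (part_inv \<alpha>) q) = q"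
proof -
  note \<alpha> = word_morphismD(1)[OF assms(1)]
  note inv = part_inv_essential[OF assms(1)]
  note part_inv = part_inv_eq_Some[OF bij_morphism_inj[OF \<alpha>]]
  show "induced_map (part_inv \<alpha>) (induced_map \<alpha> q) = q"
    by (rule morphism_cover[OF assms]) (simp add: induced_map_word_act \<alpha> word_morphismD(1)[OF inv] part_inv)
  show "induced_map \<alpha> (induced_map (part_inv \<alpha>) q) = q"
    by (rule morphism_cover[OF inv assms(2)])
      (simp add: induced_map_word_act[OF word_morphismD(1)[OF inv]],
       simp add: induced_map_word_act[OF \<alpha>] part_inv)
qed

lemma induced_map_Bij:
  assumes "\<alpha> \<in> carrier word_morphisms"
  shows "induced_map \<alpha> \<in> Bij cube"
proof -
  have "bij_betw (induced_map \<alpha>) (cube) (cube)"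
    using assms part_inv_essential[OF assms]
    by (intro bij_betw_byWitness[where f' = "induced_map (part_inv \<alpha>)"])
      (auto simp: induced_map_part_inv induced_map_cube)
  then show ?thesis by (simp add: Bij_def induced_map_def)
qed

lemma induced_map_comp:
  assumes \<alpha>: "\<alpha> \<in> carrier word_morphisms" and \<beta>: "\<beta> \<in> carrier word_morphisms"
  shows "induced_map (\<alpha> \<circ>\<^sub>m \<beta>) = compose cube (induced_map \<alpha>) (induced_map \<beta>)"
proof (rule extensionalityI[of _ "cube"])
  fix q assume q: "q \<in> cube"
  have \<alpha>\<beta>: "\<alpha> \<circ>\<^sub>m \<beta> \<in> carrier word_morphisms" by (rule essential_morphisms_closed[OF \<alpha> \<beta>])
  obtain a c p where a: "(\<alpha> \<circ>\<^sub>m \<beta>) a = Some c" and p: "p \<in> cube" "q = word_act a p"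
    using morphism_cover[OF \<alpha>\<beta> q] .
  obtain b where "\<beta> a = Some b" "\<alpha> b = Some c" using a by (auto simp: map_comp_Some_iff)
  then show "induced_map (\<alpha> \<circ>\<^sub>m \<beta>) q = compose cube (induced_map \<alpha>) (induced_map \<beta>) q"
    using a p q by (simp add: compose_eq induced_map_word_act word_morphismD(1)[OF \<alpha>] word_morphismD(1)[OF \<beta>]
        word_morphismD(1)[OF \<alpha>\<beta>])
qed (simp_all add: induced_map_def)

lemma induced_map_restrict_id:
  assumes "fg_right_ideal (A2_power n) I" "right_dense I"
  shows "induced_map (Some |` I) = (\<lambda>q\<in>cube. q)"
proof (rule extensionalityI[of _ "cube"])
  fix q assume q: "q \<in> cube"
  obtain a p where "a \<in> I" "p \<in> cube" "q = word_act a p"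
    using dense_ideal_cover[OF assms q] .
  then show "induced_map (Some |` I) q = (\<lambda>q\<in>cube. q) q"
    using q induced_map_word_act[OF bij_morphism_restrict_id[OF assms(1)], of a a p] by simp
qed (simp_all add: induced_map_def)

lemma induced_map_hom: "induced_map \<in> hom word_morphisms (BijGroup cube)"
  by (auto simp: hom_def BijGroup_def induced_map_Bij induced_map_comp)

lemma induced_map_image_subgroup:
  "subgroup (induced_map ` carrier word_morphisms) (BijGroup cube)"
proof -
  interpret B: group "BijGroup cube" by (rule group_BijGroup)
  have carr: "induced_map \<alpha> \<in> carrier (BijGroup cube)" if "\<alpha> \<in> carrier word_morphisms" for \<alpha>
    using induced_map_Bij[OF that] by (simp add: BijGroup_def)
  show ?thesis
  proof (rule B.subgroupI)
    show "induced_map ` carrier word_morphisms \<noteq> {}"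
      using restrict_id_essential[OF fg_carrier right_dense_carrier] by blast
  next
    fix f assume "f \<in> induced_map ` carrier word_morphisms"
    then obtain \<alpha> where \<alpha>: "\<alpha> \<in> carrier word_morphisms" "f = induced_map \<alpha>" by blast
    note inv = part_inv_essential[OF \<alpha>(1)]
    have "induced_map (part_inv \<alpha>) \<otimes>\<^bsub>BijGroup cube\<^esub> induced_map \<alpha> =
        induced_map (part_inv \<alpha> \<circ>\<^sub>m \<alpha>)"
      using hom_mult[OF induced_map_hom inv \<alpha>(1)] by simp
    also have "\<dots> = \<one>\<^bsub>BijGroup cube\<^esub>"
      using word_morphismD[OF \<alpha>(1)] by (simp add: part_inv_comp bij_morphism_inj induced_map_restrict_id BijGroup_def)
    finally have "inv\<^bsub>BijGroup cube\<^esub> f = induced_map (part_inv \<alpha>)"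
      unfolding \<alpha>(2) by (rule B.inv_equality) (use carr \<alpha>(1) inv in auto)
    then show "inv\<^bsub>BijGroup cube\<^esub> f \<in> induced_map ` carrier word_morphisms"
      using inv by blast
  next
    fix f g assume "f \<in> induced_map ` carrier word_morphisms" "g \<in> induced_map ` carrier word_morphisms"
    then obtain \<alpha> \<beta> where \<alpha>: "\<alpha> \<in> carrier word_morphisms" "f = induced_map \<alpha>"
      and \<beta>: "\<beta> \<in> carrier word_morphisms" "g = induced_map \<beta>" by blast
    have "f \<otimes>\<^bsub>BijGroup cube\<^esub> g = induced_map (\<alpha> \<circ>\<^sub>m \<beta>)"
      using hom_mult[OF induced_map_hom \<alpha>(1) \<beta>(1)] \<alpha>(2) \<beta>(2) by simp
    then show "f \<otimes>\<^bsub>BijGroup cube\<^esub> g \<in> induced_map ` carrier word_morphisms"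
      using essential_morphisms_closed[OF \<alpha>(1) \<beta>(1)] by blast
  qed (use carr in blast)
qed

text \<open>
  The boxes of a dense ideal cover the cube, so agreement on the ideal suffices for equality of the
  induced bijections. Conversely, equality makes the values agree wherever both morphisms are defined,
  because the action on points is faithful.
\<close>

lemma sigma_eq_induced_map_kernel:
  "sigma_cong word_morphisms = {(\<alpha>, \<beta>). \<alpha> \<in> carrier word_morphisms \<and> \<beta> \<in> carrier word_morphisms \<and>
     induced_map \<alpha> = induced_map \<beta>}"
proof -
  have "(\<exists>E. fg_right_ideal (A2_power n) E \<and> right_dense E \<and> E \<subseteq> dom \<alpha> \<and> E \<subseteq> dom \<beta> \<and>
      (\<forall>a\<in>E. \<alpha> a = \<beta> a)) \<longleftrightarrow> induced_map \<alpha> = induced_map \<beta>" (is "?agree \<longleftrightarrow> ?same")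
    if \<alpha>: "\<alpha> \<in> carrier word_morphisms" and \<beta>: "\<beta> \<in> carrier word_morphisms" for \<alpha> \<beta>
  proof
    assume ?agree
    then obtain E where E: "fg_right_ideal (A2_power n) E" "right_dense E" "E \<subseteq> dom \<alpha>"
      "\<forall>a\<in>E. \<alpha> a = \<beta> a" by blast
    show ?same
    proof (rule extensionalityI[of _ "cube"])
      fix q assume "q \<in> cube"
      then obtain a p where a: "a \<in> E" and p: "p \<in> cube" "q = word_act a p"
        by (rule dense_ideal_cover[OF E(1,2)])
      obtain b where "\<alpha> a = Some b" using a E(3) by blast
      moreover have "\<beta> a = Some b" using a E(4) calculation by simp
      ultimately show "induced_map \<alpha> q = induced_map \<beta> q"
        using p by (simp add: induced_map_word_act word_morphismD(1)[OF \<alpha>] word_morphismD(1)[OF \<beta>])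
    qed (simp_all add: induced_map_def)
  next
    assume ?same
    obtain N M where "deep_words N \<subseteq> dom \<alpha>" "deep_words M \<subseteq> dom \<beta>"
      using right_dense_fg_deep word_morphismD[OF \<alpha>] word_morphismD[OF \<beta>] by metis
    then have sub: "deep_words (max N M) \<subseteq> dom \<alpha>" "deep_words (max N M) \<subseteq> dom \<beta>"
      using deep_words_antimono[of N "max N M"] deep_words_antimono[of M "max N M"] by auto
    have "\<alpha> a = \<beta> a" if a: "a \<in> deep_words (max N M)" for a
    proof -
      obtain b c where bc: "\<alpha> a = Some b" "\<beta> a = Some c" using a sub by blast
      have "word_act b p = word_act c p" if "p \<in> cube" for p
        using \<open>?same\<close> induced_map_word_act[OF word_morphismD(1)[OF \<alpha>] bc(1) that]
          induced_map_word_act[OF word_morphismD(1)[OF \<beta>] bc(2) that] by simp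
      then have "b = c"
        using bij_morphism_closed(2)[OF word_morphismD(1)[OF \<alpha>] bc(1)]
          bij_morphism_closed(2)[OF word_morphismD(1)[OF \<beta>] bc(2)] by (intro word_act_faithful) auto
      then show ?thesis using bc by simp
    qed
    then show ?agree using fg_deep_words right_dense_deep_words sub by blast
  qed
  then show ?thesis unfolding sigma_essential_morphisms by blast
qed

lemma G_group_A2_power:
  "group (G_group (A2_power n))"
  "G_group (A2_power n) \<cong> (BijGroup cube)\<lparr>carrier := induced_map ` carrier word_morphisms\<rparr>"
proof -
  have one: "\<one>\<^bsub>word_morphisms\<^esub> \<in> carrier word_morphisms" "induced_map \<one>\<^bsub>word_morphisms\<^esub> = \<one>\<^bsub>BijGroup cube\<^esub>"
    using restrict_id_essential[OF fg_carrier right_dense_carrier]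
      induced_map_restrict_id[OF fg_carrier right_dense_carrier]
    by (simp_all add: BijGroup_def)
  have closed: "\<alpha> \<otimes>\<^bsub>word_morphisms\<^esub> \<beta> \<in> carrier word_morphisms"
    if "\<alpha> \<in> carrier word_morphisms" "\<beta> \<in> carrier word_morphisms" for \<alpha> \<beta>
    using essential_morphisms_closed[OF that] by simp
  note * = quotient_by_kernel[where F = induced_map and T = word_morphisms, OF group_BijGroup induced_map_hom _ one(1)
      induced_map_image_subgroup sigma_eq_induced_map_kernel one(2)]
  show "group (G_group (A2_power n))"
    "G_group (A2_power n) \<cong> (BijGroup cube)\<lparr>carrier := induced_map ` carrier word_morphisms\<rparr>"
    unfolding G_group_def Let_def by (rule *, rule closed, assumption+)+
qed

section \<open>Dyadic patterns\<close>

definition letter :: "nat \<Rightarrow> bool \<Rightarrow> nat \<Rightarrow> bool list" where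
  "letter i c = (\<lambda>j\<in>{..<n}. if j = i then [c] else [])"

lemma letter_words [simp]: "letter i c \<in> words"
  by (simp add: letter_def)

lemma letter_apply [simp]: "j < n \<Longrightarrow> letter i c j = (if j = i then [c] else [])"
  by (simp add: letter_def)

lemma box_one: "box \<one>\<^bsub>A2_power n\<^esub> = cube"
  unfolding box_eq_hbox by (rule hbox_cong) (simp add: one_A2_power)

text \<open>
  The link between geometry and combinatorics: halving a box in direction \<open>i\<close> appends a letter to
  the \<open>i\<close>-th component of its word tuple.
\<close>

lemma hbox_halves:
  assumes "hbox n a b = box x" "i < n" "m = (a i + b i) / 2"
  shows "hbox n a (b(i := m)) = box (x \<cdot> letter i False)"
    and "hbox n (a(i := m)) b = box (x \<cdot> letter i True)"
proof -
  have ab: "a j = bits_act (x j) 0" "b j = bits_act (x j) 1" if "j < n" for j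
    using hbox_eq_box[OF assms(1) that] .
  show "hbox n a (b(i := m)) = box (x \<cdot> letter i False)"
    "hbox n (a(i := m)) b = box (x \<cdot> letter i True)"
    unfolding box_eq_hbox using ab assms(2,3)
    by (auto intro!: hbox_cong simp: bits_act_half)
qed

lemma box_halves_Un:
  assumes "i < n"
  shows "box (x \<cdot> letter i False) \<union> box (x \<cdot> letter i True) = box x"
proof
  show "box (x \<cdot> letter i False) \<union> box (x \<cdot> letter i True) \<subseteq> box x"
    using box_mult_subset by blast
  show "box x \<subseteq> box (x \<cdot> letter i False) \<union> box (x \<cdot> letter i True)"
  proof
    fix q assume "q \<in> box x"
    then obtain p where p: "p \<in> cube" "q = word_act x p" by (auto simp: box_def)
    define c where "c \<longleftrightarrow> p i \<ge> 1/2"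
    \<comment> \<open>The first binary digit \<open>c\<close> of \<open>p i\<close> is split off.\<close>
    define p' where "p' = p(i := 2 * p i - of_bool c)"
    have p': "p' \<in> cube"
      using p(1) assms by (auto simp: hbox_iff p'_def c_def extensional_def)
    have "word_act (letter i c) p' = p"
      using p(1) p' by (intro cube_eqI) (auto simp: p'_def field_simps)
    then have "q = word_act (x \<cdot> letter i c) p'" by (simp add: p(2) word_act_mult)
    then show "q \<in> box (x \<cdot> letter i False) \<union> box (x \<cdot> letter i True)"
      using p' by (cases c) (auto simp: box_def)
  qed
qed

lemma box_halves_disjoint:
  assumes "i < n"
  shows "box (x \<cdot> letter i False) \<inter> box (x \<cdot> letter i True) = {}"
proof -
  have False if pq: "p \<in> cube" "q \<in> cube"
    and eq: "word_act (x \<cdot> letter i False) p = word_act (x \<cdot> letter i True) q" for p q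
  proof -
    have "word_act (letter i False) p = word_act (letter i True) q"
      using eq unfolding word_act_mult by (rule word_act_inj[rotated 2]) (use pq in simp_all)
    from fun_cong[OF this, of i] have "p i = 1 + q i" using assms by simp
    then show False using pq assms by (force simp: hbox_iff)
  qed
  then show ?thesis by (auto simp: box_def)
qed

lemma dyadic_pattern_boxes:
  assumes "P \<in> dyadic_patterns n"
  shows "\<forall>B\<in>P. \<exists>x\<in>words. B = box x"
  using assms
proof induction
  case trivial
  then show ?case using box_one one_closed by blast
next
  case (halve P a b i m)
  then obtain x where "x \<in> words" "hbox n a b = box x" by blast
  with hbox_halves[OF this(2) halve.hyps(3,4)] halve.IH word_mult_closed show ?case by blast
qed

text \<open>
  Induction over dyadic patterns with boxes replaced by word tuples, so that the endpoints of boxes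
  do not appear in later arguments.
\<close>

lemma dyadic_pattern_word_induct [consumes 1, case_names trivial halve]:
  assumes P: "P \<in> dyadic_patterns n" and triv: "\<Phi> {cube}"
    and step: "\<And>P x i. P \<in> dyadic_patterns n \<Longrightarrow> \<Phi> P \<Longrightarrow> box x \<in> P \<Longrightarrow> i < n \<Longrightarrow>
      \<Phi> (P - {box x} \<union> {box (x \<cdot> letter i False), box (x \<cdot> letter i True)})"
  shows "\<Phi> P"
  using P
proof induction
  case (halve P a b i m)
  then obtain x where x: "hbox n a b = box x" using dyadic_pattern_boxes by blast
  show ?case
    using step[of P x i] halve x hbox_halves[OF x halve.hyps(3,4)] by simp
qed (rule triv)

lemma dyadic_halve_box:
  assumes "P \<in> dyadic_patterns n" "box x \<in> P" "i < n"
  shows "P - {box x} \<union> {box (x \<cdot> letter i False), box (x \<cdot> letter i True)} \<in> dyadic_patterns n"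
proof -
  let ?a = "\<lambda>i. bits_act (x i) 0" and ?b = "\<lambda>i. bits_act (x i) 1"
  have x: "hbox n ?a ?b = box x" by (simp add: box_eq_hbox)
  show ?thesis
    using dyadic_patterns.halve[of P n ?a ?b i, OF assms(1) _ assms(3) refl] assms(2)
      hbox_halves[OF x assms(3) refl] x by simp
qed

lemma finite_dyadic_pattern: "P \<in> dyadic_patterns n \<Longrightarrow> finite P"
  by (induction rule: dyadic_patterns.induct) auto

lemma Union_dyadic_pattern: "P \<in> dyadic_patterns n \<Longrightarrow> \<Union>P = cube"
proof (induction rule: dyadic_pattern_word_induct)
  case (halve P x i)
  have "\<Union>(P - {box x} \<union> {box (x \<cdot> letter i False), box (x \<cdot> letter i True)})
      = \<Union>(P - {box x}) \<union> box x"
    unfolding box_halves_Un[OF halve.hyps(3), of x, symmetric] by auto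
  also have "\<dots> = \<Union>P" using halve.hyps(2) by blast
  finally show ?case using halve.IH by simp
qed simp

lemma dyadic_pattern_disjoint:
  assumes "P \<in> dyadic_patterns n"
  shows "B \<in> P \<Longrightarrow> C \<in> P \<Longrightarrow> B \<noteq> C \<Longrightarrow> B \<inter> C = {}"
  using assms
proof (induction arbitrary: B C rule: dyadic_pattern_word_induct)
  case (halve P x i)
  let ?B0 = "box (x \<cdot> letter i False)" and ?B1 = "box (x \<cdot> letter i True)"
  have old: "D \<inter> ?B0 = {}" "D \<inter> ?B1 = {}" if "D \<in> P - {box x}" for D
    using halve.IH[of D "box x"] halve.hyps(2) that box_mult_subset[of x] by blast+
  have halves: "?B0 \<inter> ?B1 = {}" by (rule box_halves_disjoint[OF halve.hyps(3)])
  have "B \<in> P - {box x} \<Longrightarrow> C \<in> P - {box x} \<Longrightarrow> B \<inter> C = {}"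
    using halve.IH halve.prems(3) by blast
  moreover have "B \<in> P - {box x} \<or> B = ?B0 \<or> B = ?B1" "C \<in> P - {box x} \<or> C = ?B0 \<or> C = ?B1"
    using halve.prems(1,2) by blast+
  ultimately show ?case
    using old[of B] old[of C] halves halve.prems(3) by (elim disjE; simp add: Int_commute)
qed simp

definition words_of_length :: "(nat \<Rightarrow> nat) \<Rightarrow> (nat \<Rightarrow> bool list) set" where
  "words_of_length k = {s \<in> words. \<forall>i<n. length (s i) = k i}"

lemma finite_words_of_length: "finite (words_of_length (\<lambda>_. N))"
  by (rule finite_subset[OF _ finite_short_words[of N]]) (auto simp: words_of_length_def)

lemma words_of_length_Suc:
  assumes "i < n" "k i = Suc m"
  shows "words_of_length k = (\<lambda>s. letter i False \<cdot> s) ` words_of_length (k(i := m)) \<union>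
    (\<lambda>s. letter i True \<cdot> s) ` words_of_length (k(i := m))"
proof (intro equalityI subsetI)
  fix s assume s: "s \<in> words_of_length k"
  then have "length (s i) = Suc m" using assms by (simp add: words_of_length_def)
  then obtain c w where cw: "s i = c # w" "length w = m" by (cases "s i") auto
  let ?s = "\<lambda>j\<in>{..<n}. if j = i then w else s j"
  have "s = letter i c \<cdot> ?s"
    using s cw by (intro words_eqI) (auto simp: words_of_length_def)
  moreover have "?s \<in> words_of_length (k(i := m))"
    using s cw by (auto simp: words_of_length_def)
  ultimately have "s \<in> (\<lambda>s. letter i c \<cdot> s) ` words_of_length (k(i := m))" by (rule image_eqI)
  then show "s \<in> (\<lambda>s. letter i False \<cdot> s) ` words_of_length (k(i := m)) \<union>
    (\<lambda>s. letter i True \<cdot> s) ` words_of_length (k(i := m))"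
    by (cases c) simp_all
qed (use assms in \<open>auto simp: words_of_length_def\<close>)

text \<open>
  By induction on the total length: halve the box in a direction in which the grid is not yet
  exhausted, then refine the two halves one after the other. Disjointness of the boxes of a
  pattern guarantees that the two refinements do not interfere when they are removed and inserted
  in sets.
\<close>

lemma dyadic_refine_box:
  assumes "P \<in> dyadic_patterns n" "x \<in> words" "box x \<in> P"
  shows "P - {box x} \<union> (\<lambda>s. box (x \<cdot> s)) ` words_of_length k \<in> dyadic_patterns n"
  using assms
proof (induction "\<Sum>i<n. k i" arbitrary: P x k)
  case 0
  then have "words_of_length k = {\<one>\<^bsub>A2_power n\<^esub>}"
    by (auto simp: words_of_length_def one_A2_power intro!: words_eqI)
  then show ?case using 0 by (simp add: insert_absorb)
next
  case (Suc d)
  have "\<exists>i<n. k i \<noteq> 0"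
    using Suc.hyps(2) by (metis lessThan_iff nat.distinct(1) sum.neutral)
  then obtain i m where i: "i < n" "k i = Suc m" using not0_implies_Suc by blast
  let ?k = "k(i := m)"
  let ?x0 = "x \<cdot> letter i False" and ?x1 = "x \<cdot> letter i True"
  let ?R0 = "(\<lambda>s. box (?x0 \<cdot> s)) ` words_of_length ?k"
  let ?R1 = "(\<lambda>s. box (?x1 \<cdot> s)) ` words_of_length ?k"
  have "(\<Sum>j<n. k j) = Suc (\<Sum>j<n. ?k j)"
    using i by (simp add: sum.remove[of "{..<n}" i])
  then have d: "d = (\<Sum>j<n. ?k j)" using Suc.hyps(2) by simp
  have disj: "box ?x0 \<inter> box ?x1 = {}" by (rule box_halves_disjoint[OF i(1)])
  have new: "box (x \<cdot> s) \<notin> P - {box x}" for s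
    using dyadic_pattern_disjoint[OF Suc.prems(1), of "box (x \<cdot> s)" "box x"] Suc.prems(3)
      box_mult_subset[of x s] box_nonempty[of "x \<cdot> s"] by blast
  have R0: "box ?x1 \<notin> ?R0"
    using disj box_mult_subset[of ?x0] box_nonempty[of ?x1] by blast
  define P1 where "P1 = P - {box x} \<union> {box ?x0, box ?x1}"
  have P1: "P1 \<in> dyadic_patterns n"
    unfolding P1_def by (rule dyadic_halve_box[OF Suc.prems(1,3) i(1)])
  define P2 where "P2 = P1 - {box ?x0} \<union> ?R0"
  have P2: "P2 \<in> dyadic_patterns n"
    unfolding P2_def by (rule Suc.hyps(1)[OF d P1]) (auto simp: P1_def)
  have "box ?x1 \<noteq> box ?x0" using disj box_nonempty by blast
  then have "box ?x1 \<in> P2" by (auto simp: P2_def P1_def)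
  then have "P2 - {box ?x1} \<union> ?R1 \<in> dyadic_patterns n"
    by (intro Suc.hyps(1)[OF d P2]) auto
  also have "P2 - {box ?x1} \<union> ?R1 = P - {box x} \<union> (?R0 \<union> ?R1)"
    using new[of "letter i False"] new[of "letter i True"] R0 unfolding P2_def P1_def by blast
  also have "?R0 \<union> ?R1 = (\<lambda>s. box (x \<cdot> s)) ` words_of_length k"
  proof -
    have "(\<lambda>s. box (x \<cdot> letter i c \<cdot> s)) ` words_of_length ?k =
        (\<lambda>s. box (x \<cdot> s)) ` (\<lambda>s. letter i c \<cdot> s) ` words_of_length ?k" for c
      unfolding image_image using Suc.prems(2)
      by (intro image_cong) (auto simp: m_assoc words_of_length_def)
    then show ?thesis unfolding words_of_length_Suc[of i k m, OF i] image_Un by simp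
  qed
  finally show ?case .
qed

lemma dyadic_refine_boxes:
  assumes P: "P \<in> dyadic_patterns n" and A: "finite A" "A \<subseteq> words" "box ` A \<subseteq> P"
  shows "P - box ` A \<union> (\<Union>x\<in>A. (\<lambda>s. box (x \<cdot> s)) ` words_of_length (k x)) \<in> dyadic_patterns n"
  using A
proof (induction A)
  case empty
  then show ?case using P by simp
next
  case (insert x A)
  let ?R = "\<lambda>x. (\<lambda>s. box (x \<cdot> s)) ` words_of_length (k x)"
  have x: "x \<in> words" "box x \<in> P" and A: "A \<subseteq> words" "box ` A \<subseteq> P"
    using insert.prems by auto
  have xA: "box x \<noteq> box a" if "a \<in> A" for a
    using box_inj[of x a] x A that insert.hyps by blast
  have "box x \<notin> ?R a" if "a \<in> A" for a
    using dyadic_pattern_disjoint[OF P x(2), of "box a"] A that xA[OF that]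
      box_mult_subset[of a] box_nonempty[of x] by blast
  then have eq: "P - box ` A \<union> (\<Union>x\<in>A. ?R x) - {box x} \<union> ?R x =
      P - box ` insert x A \<union> (\<Union>x\<in>insert x A. ?R x)"
    by blast
  have "box x \<in> P - box ` A \<union> (\<Union>x\<in>A. ?R x)" using x xA by blast
  from dyadic_refine_box[OF insert.IH[OF A] x(1) this, of "k x"] show ?case unfolding eq .
qed

lemma dyadic_grid: "box ` words_of_length k \<in> dyadic_patterns n"
proof -
  have "(\<lambda>s. box (\<one>\<^bsub>A2_power n\<^esub> \<cdot> s)) ` words_of_length k = box ` words_of_length k"
    by (auto simp: words_of_length_def intro!: image_cong)
  then show ?thesis
    using dyadic_refine_box[of "{cube}" "\<one>\<^bsub>A2_power n\<^esub>" k] dyadic_patterns.trivial[of n]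
    by (simp add: box_one)
qed

section \<open>Brin's group as the group of induced bijections\<close>

text \<open>
  Of two tuples with a common right multiple, the one that is longer in each component is itself a
  multiple of the other.
\<close>

lemma word_prefix:
  assumes "z \<in> words" "z \<cdot> s = x \<cdot> t" "\<And>i. i < n \<Longrightarrow> length (x i) \<le> length (z i)"
  obtains u where "u \<in> words" "z = x \<cdot> u" "\<And>i. i < n \<Longrightarrow> length (u i) = length (z i) - length (x i)"
proof (rule that[of "\<lambda>i\<in>{..<n}. drop (length (x i)) (z i)"])
  have "z i = x i @ drop (length (x i)) (z i)" if "i < n" for i
    using fun_cong[OF assms(2), of i] assms(3)[OF that] that
    by (simp add: append_eq_append_conv_if split: if_splits) (metis append_take_drop_id)
  then show "z = x \<cdot> (\<lambda>i\<in>{..<n}. drop (length (x i)) (z i))"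
    using assms(1) by (intro words_eqI) simp_all
qed auto

text \<open>
  The source pattern consists of the boxes of \<open>x s\<close>, where \<open>x\<close> runs through a grid of depth \<open>N\<close>
  and \<open>s\<close> through the tuples of length \<open>M\<close> minus the length of \<open>\<alpha>(x)\<close>; their images are the cells of the
  grid of depth \<open>M\<close>. Every cell is hit since the induced map is onto.
\<close>

lemma induced_map_in_brin_group:
  assumes \<alpha>: "\<alpha> \<in> carrier (word_morphisms)"
  shows "induced_map \<alpha> \<in> carrier (brin_group n)"
proof -
  note bij = word_morphismD(1)[OF \<alpha>]
  note inj = bij_morphism_inj[OF bij]
  obtain N where N: "deep_words N \<subseteq> dom \<alpha>"
    using right_dense_fg_deep[OF word_morphismD(2,3)[OF \<alpha>]] .
  define A where "A = words_of_length (\<lambda>_. N)"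
  define y where "y x = the (\<alpha> x)" for x
  have A: "finite A" "A \<subseteq> words" "A \<subseteq> deep_words N"
    by (auto simp: A_def finite_words_of_length) (auto simp: words_of_length_def deep_words_def)
  have y: "\<alpha> x = Some (y x)" "y x \<in> words" if "x \<in> A" for x
  proof -
    show "\<alpha> x = Some (y x)" using that A(3) N by (auto simp: y_def dom_def)
    then show "y x \<in> words" using bij_morphism_closed(2)[OF bij] by blast
  qed
  define M where "M = Max (insert 0 ((\<lambda>(x, i). length (y x i)) ` (A \<times> {..<n})))"
  have M: "length (y x i) \<le> M" if "x \<in> A" "i < n" for x i
    unfolding M_def using A(1) that by (intro Max_ge) force+
  \<comment> \<open>With these lengths every \<open>y x \<cdot> s\<close> has length exactly \<open>M\<close>.\<close>
  define k where "k x i = M - length (y x i)" for x i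
  define X where "X = (\<Union>x\<in>A. (\<lambda>s. x \<cdot> s) ` words_of_length (k x))"
  have X_words: "X \<subseteq> words" by (auto simp: X_def)
  have X: "\<exists>w\<in>words_of_length (\<lambda>_. M). \<alpha> z = Some w" if "z \<in> X" for z
  proof -
    obtain x s where z: "x \<in> A" "s \<in> words_of_length (k x)" "z = x \<cdot> s"
      using \<open>z \<in> X\<close> by (auto simp: X_def)
    have "s \<in> words" using z(2) by (simp add: words_of_length_def)
    then have "\<alpha> z = Some (y x \<cdot> s)" unfolding z(3) by (rule bij_morphism_mult[OF bij y(1)[OF z(1)]])
    moreover have "y x \<cdot> s \<in> words_of_length (\<lambda>_. M)"
      using z(2) M[OF z(1)] by (auto simp: words_of_length_def k_def)
    ultimately show ?thesis by blast
  qed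
  have X_onto: "\<exists>z\<in>X. \<alpha> z = Some w" if w: "w \<in> words_of_length (\<lambda>_. M)" for w
  proof -
    have w_words: "w \<in> words" using w by (simp add: words_of_length_def)
    let ?o = "\<lambda>i\<in>{..<n}. 0 :: real"
    \<comment> \<open>The grid box that contains the preimage of the corner of the box of \<open>w\<close> provides the prefix \<open>x\<close>.\<close>
    define q where "q = induced_map (part_inv \<alpha>) (word_act w ?o)"
    have q: "q \<in> cube" "induced_map \<alpha> q = word_act w ?o"
      using induced_map_cube[OF part_inv_essential[OF \<alpha>]] induced_map_part_inv(2)[OF \<alpha>]
      by (auto simp: q_def)
    obtain x r where x: "x \<in> words" "\<And>i. i < n \<Longrightarrow> length (x i) = N" and r: "r \<in> cube" "q = word_act x r"
      using cube_digits[OF q(1), of "\<lambda>_. N"] by metis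
    then have xA: "x \<in> A" by (simp add: A_def words_of_length_def)
    have "word_act w ?o = word_act (y x) r"
      using q(2) induced_map_word_act[OF bij y(1)[OF xA] r(1)] r(2) by simp
    then obtain s t where "w \<cdot> s = y x \<cdot> t"
      using word_act_meet[OF origin_cube r(1)] by metis
    then obtain u where u: "u \<in> words" "w = y x \<cdot> u" "\<And>i. i < n \<Longrightarrow> length (u i) = length (w i) - length (y x i)"
      using word_prefix[OF w_words, of s "y x" t] M[OF xA] w by (auto simp: words_of_length_def)
    have "u \<in> words_of_length (k x)" using w u(1,3) by (simp add: words_of_length_def k_def)
    then have "x \<cdot> u \<in> X" using xA by (auto simp: X_def)
    moreover have "\<alpha> (x \<cdot> u) = Some w"
      unfolding u(2) by (rule bij_morphism_mult[OF bij y(1)[OF xA] u(1)])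
    ultimately show ?thesis by blast
  qed
  have y_X: "\<alpha> z = Some (y z)" "y z \<in> words_of_length (\<lambda>_. M)" if "z \<in> X" for z
    using X[OF that] by (auto simp: y_def)
  have bij_y: "bij_betw y X (words_of_length (\<lambda>_. M))"
    unfolding bij_betw_def
  proof
    show "inj_on y X"
    proof (rule inj_onI)
      fix z z' assume "z \<in> X" "z' \<in> X" "y z = y z'"
      then show "z = z'" using y_X[of z] y_X[of z'] inj_on_domD[OF inj] by metis
    qed
    show "y ` X = words_of_length (\<lambda>_. M)"
    proof (intro equalityI subsetI)
      fix w assume "w \<in> words_of_length (\<lambda>_. M)"
      then obtain z where z: "z \<in> X" "\<alpha> z = Some w" using X_onto by blast
      then have "w = y z" by (simp add: y_def)
      with z(1) show "w \<in> y ` X" by blast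
    qed (use y_X in blast)
  qed
  have inj_box: "inj_on (box) (words)" by (rule inj_onI) (rule box_inj)
  have bij_box: "bij_betw (box) Z (box ` Z)" if "Z \<subseteq> words" for Z
    using inj_on_subset[OF inj_box that] by (simp add: bij_betw_def)
  define \<phi> where "\<phi> = box \<circ> y \<circ> inv_into X (box)"
  have "bij_betw \<phi> (box ` X) (box ` words_of_length (\<lambda>_. M))"
    unfolding \<phi>_def
    by (intro bij_betw_trans[OF bij_betw_inv_into[OF bij_box[OF X_words]]] bij_betw_trans[OF bij_y] bij_box)
      (auto simp: words_of_length_def)
  moreover have "affine_box_map n (induced_map \<alpha>) B (\<phi> B)" if B: "B \<in> box ` X" for B
  proof -
    obtain z where z: "z \<in> X" "B = box z" using B by blast
    have "\<phi> (box z) = box (y z)"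
      using bij_betw_inv_into_left[OF bij_box[OF X_words] z(1)] by (simp add: \<phi>_def)
    then show ?thesis
      unfolding z(2) by (simp add: affine_box_map_iff induced_map_word_act[OF bij y_X(1)[OF z(1)]])
  qed
  moreover have "box ` X \<in> dyadic_patterns n"
  proof -
    have "box ` A \<in> dyadic_patterns n" unfolding A_def by (rule dyadic_grid)
    from dyadic_refine_boxes[OF this A(1,2), of k]
    show ?thesis by (simp add: X_def image_UN image_image)
  qed
  ultimately have "\<exists>P\<in>dyadic_patterns n. \<exists>Q\<in>dyadic_patterns n. \<exists>\<phi>.
      bij_betw \<phi> P Q \<and> (\<forall>B\<in>P. affine_box_map n (induced_map \<alpha>) B (\<phi> B))"
    using dyadic_grid by blast
  then show ?thesis using induced_map_Bij[OF \<alpha>] by (simp add: brin_group_def)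
qed

text \<open>
  The maps that exchange prefixes on all sufficiently long tuples are exactly the induced ones: the
  exchange itself is a morphism on the ideal of these tuples. Its range is dense because \<open>f\<close> is onto.
\<close>

lemma brin_group_in_induced_map:
  assumes "f \<in> carrier (brin_group n)"
  shows "f \<in> induced_map ` carrier (word_morphisms)"
proof -
  obtain P Q \<phi> where f: "f \<in> Bij cube" and P: "P \<in> dyadic_patterns n" and Q: "Q \<in> dyadic_patterns n"
    and \<phi>: "bij_betw \<phi> P Q" and affine: "\<And>B. B \<in> P \<Longrightarrow> affine_box_map n f B (\<phi> B)"
    using assms by (auto simp: brin_group_def)
  have f_bij: "bij_betw f (cube) (cube)" and f_ext: "f \<in> extensional (cube)"
    using f by (auto simp: Bij_def)
  have "\<exists>x y. x \<in> words \<and> y \<in> words \<and> B = box x \<and> \<phi> B = box y" if "B \<in> P" for B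
  proof -
    have "\<phi> B \<in> Q" using bij_betwE[OF \<phi>] that by blast
    with that obtain x y where "x \<in> words" "B = box x" "y \<in> words" "\<phi> B = box y"
      using dyadic_pattern_boxes[OF P] dyadic_pattern_boxes[OF Q] by metis
    then show ?thesis by blast
  qed
  then obtain x y where xy: "\<And>B. B \<in> P \<Longrightarrow> x B \<in> words \<and> y B \<in> words \<and> B = box (x B) \<and> \<phi> B = box (y B)"
    by metis
  have f_box: "f (word_act (x B) p) = word_act (y B) p" if "B \<in> P" "p \<in> cube" for B p
    using affine[OF that(1)] xy[OF that(1)] affine_box_map_iff[of f "x B" "y B"] that(2) by simp
  define N where "N = Max (insert 0 ((\<lambda>(B, i). length (x B i)) ` (P \<times> {..<n})))"
  have N: "length (x B i) \<le> N" if "B \<in> P" "i < n" for B i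
    unfolding N_def using finite_dyadic_pattern[OF P] that by (intro Max_ge) force+
  \<comment> \<open>The corner of the box of \<open>z\<close> selects the box \<open>B\<close> of the pattern that contains the box of \<open>z\<close>.\<close>
  have "\<exists>w\<in>words. \<forall>p\<in>cube. f (word_act z p) = word_act w p" if z: "z \<in> deep_words N" for z
  proof -
    let ?o = "\<lambda>i\<in>{..<n}. 0 :: real"
    have "word_act z ?o \<in> \<Union>P" unfolding Union_dyadic_pattern[OF P] by simp
    then obtain B where B: "B \<in> P" "word_act z ?o \<in> box (x B)" using xy by blast
    then obtain r where "r \<in> cube" "word_act z ?o = word_act (x B) r" by (auto simp: box_def)
    then obtain s t where st: "z \<cdot> s = x B \<cdot> t" using word_act_meet[OF origin_cube] by metis
    have "length (x B i) \<le> length (z i)" if "i < n" for i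
      using N[OF B(1) that] z that by (force simp: deep_words_def)
    then obtain u where "u \<in> words" "z = x B \<cdot> u"
      using word_prefix[OF _ st] z by (auto simp: deep_words_def)
    then have "\<forall>p\<in>cube. f (word_act z p) = word_act (y B \<cdot> u) p"
      using f_box[OF B(1)] by (simp add: word_act_mult)
    then show ?thesis using word_mult_closed by blast
  qed
  then obtain w where w: "\<And>z. z \<in> deep_words N \<Longrightarrow> w z \<in> words"
    and f_w: "\<And>z p. z \<in> deep_words N \<Longrightarrow> p \<in> cube \<Longrightarrow> f (word_act z p) = word_act (w z) p"
    by metis
  define \<alpha> where "\<alpha> z = (if z \<in> deep_words N then Some (w z) else None)" for z
  have \<alpha>_Some: "\<alpha> z = Some v \<longleftrightarrow> z \<in> deep_words N \<and> v = w z" for z v by (auto simp: \<alpha>_def)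
  have dom: "dom \<alpha> = deep_words N" by (auto simp: dom_def \<alpha>_def)
  have mor: "\<alpha> (a \<cdot> s) = Some (b \<cdot> s)" if "s \<in> words" "\<alpha> a = Some b" for a b s
  proof -
    have a: "a \<in> deep_words N" "b = w a" using that(2) by (auto simp: \<alpha>_Some)
    have as: "a \<cdot> s \<in> deep_words N" using fg_right_mult[OF fg_deep_words a(1) that(1)] .
    have "w (a \<cdot> s) = b \<cdot> s"
    proof (rule word_act_faithful)
      fix p assume p: "p \<in> cube"
      show "word_act (w (a \<cdot> s)) p = word_act (b \<cdot> s) p"
        using f_w[OF as p] f_w[OF a(1), of "word_act s p"] p a(2) by (simp add: word_act_mult)
    qed (use w as in auto)
    with as show ?thesis by (simp add: \<alpha>_Some)
  qed
  have inj: "inj_on \<alpha> (dom \<alpha>)"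
  proof (rule inj_onI)
    fix z z' assume "z \<in> dom \<alpha>" "z' \<in> dom \<alpha>" "\<alpha> z = \<alpha> z'"
    then have zz: "z \<in> deep_words N" "z' \<in> deep_words N" "w z = w z'"
      by (auto simp: dom \<alpha>_def)
    show "z = z'"
    proof (rule word_act_faithful)
      fix p assume p: "p \<in> cube"
      have "f (word_act z p) = f (word_act z' p)" using zz f_w p by simp
      then show "word_act z p = word_act z' p"
        by (rule inj_onD[OF bij_betw_imp_inj_on[OF f_bij]]) (use p in simp_all)
    qed (use zz in \<open>auto simp: deep_words_def\<close>)
  qed
  have "fg_right_ideal (A2_power n) {b. \<exists>a\<in>dom \<alpha>. \<alpha> a = Some b}"
    using w by (intro fg_morphic_image mor) (auto simp: dom fg_deep_words ran_def \<alpha>_Some)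
  moreover have "{b. \<exists>a\<in>dom \<alpha>. \<alpha> a = Some b} = ran \<alpha>" by (auto simp: ran_def)
  ultimately have bij: "bij_morphism (A2_power n) \<alpha>"
    using inj mor by (simp add: bij_morphism_def dom fg_deep_words)
  have "right_dense (ran \<alpha>)"
    unfolding right_dense_def
  proof
    fix v assume v: "v \<in> words"
    let ?o = "\<lambda>i\<in>{..<n}. 0 :: real"
    have "word_act v ?o \<in> f ` cube" using f_bij by (simp add: bij_betw_def)
    then obtain q where q: "q \<in> cube" "word_act v ?o = f q" by blast
    obtain z r where z: "z \<in> deep_words N" and r: "r \<in> cube" "q = word_act z r"
      using deep_words_cover[OF q(1)] .
    have "word_act v ?o = word_act (w z) r" using q(2) r f_w[OF z r(1)] by simp
    then obtain s t where "s \<in> words" "t \<in> words" "v \<cdot> s = w z \<cdot> t"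
      using word_act_meet[OF origin_cube r(1)] by metis
    moreover have "\<alpha> z = Some (w z)" using z by (simp add: \<alpha>_Some)
    ultimately show "\<exists>s\<in>words. v \<cdot> s \<in> ran \<alpha>" using mor by (metis ranI)
  qed
  then have \<alpha>: "\<alpha> \<in> carrier (word_morphisms)"
    using bij right_dense_deep_words by (simp add: carrier_essential_morphisms dom)
  have "f = induced_map \<alpha>"
  proof (rule extensionalityI[OF f_ext])
    fix q assume "q \<in> cube"
    then obtain z r where z: "z \<in> deep_words N" and r: "r \<in> cube" "q = word_act z r"
      by (rule deep_words_cover)
    have "\<alpha> z = Some (w z)" using z by (simp add: \<alpha>_Some)
    then show "f q = induced_map \<alpha> q"
      using f_w[OF z r(1)] induced_map_word_act[OF bij _ r(1)] r(2) by simp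
  qed (simp add: induced_map_def)
  then show ?thesis using \<alpha> by blast
qed

lemma brin_group_eq:
  "brin_group n = (BijGroup cube)\<lparr>carrier := induced_map ` carrier (word_morphisms)\<rparr>"
proof -
  have "carrier (brin_group n) = induced_map ` carrier (word_morphisms)"
    using induced_map_in_brin_group brin_group_in_induced_map by blast
  then show ?thesis by (simp add: brin_group_def)
qed

end

theorem proposition13p3:
  fixes n :: nat
  assumes "n \<ge> 1"
  shows "group (G_group (A2_power n)) \<and> group (brin_group n) \<and>
    G_group (A2_power n) \<cong> brin_group n"
proof (intro conjI)
  show "group (G_group (A2_power n))" by (rule G_group_A2_power)
  show "group (brin_group n)"
    unfolding brin_group_eq
    by (rule subgroup.subgroup_is_group[OF induced_map_image_subgroup group_BijGroup])
  show "G_group (A2_power n) \<cong> brin_group n"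
    unfolding brin_group_eq by (rule G_group_A2_power)
qed

end
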